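(* Let $S^N=\{S^N_t\}_{t\ge 0}$ ($N\in\mathbb{N}$) be the logarithmic price processes with $S^N_0=0$ defined by $$S^N_t = \frac{1}{N}\,\Pi_+\Big(\sum_{a=1}^N\int_0^t\lambda_+(x^a_u,S^N_u)\,du\Big)-\frac1N\,\Pi_-\Big(\sum_{a=1}^N\int_0^t\lambda_-(x^a_u,S^N_u)\,du\Big),\qquad t\ge 0,$$ and let $\{s_t\}_{t\ge0}$ be the solution of the ordinary differential equation $\frac{d}{dt}s_t=\bar\lambda(s_t)$, $s_0=0$. Then, as $N\to\infty$, the processes $\{S^N_t\}_{t\ge0}$ converge almost surely to the deterministic process $\{s_t\}_{t\ge0}$: $$\lim_{N\to\infty}S^N_t=s_t\qquad \mathbb{P}^*\text{-a.s.},$$ where the convergence is uniform over compact time intervals.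
   Context: **Semi-Markov processes.** $E\subset\mathbb{R}$ is a finite set with $0\in E$. A semi-Markov process $x$ on $E$ is given by $E$-valued random variables $\xi_n$ and times $0=T_0\le T_1\le T_2\le\cdots$ through $x_t=\sum_{n\ge0}\xi_n\mathbf{1}_{[T_n,T_{n+1})}(t)$, where $$\mathbb{P}\{\xi_{n+1}=j,\,T_{n+1}-T_n\le t\mid \xi_0,\dots,\xi_n;T_0,\dots,T_n\}=\mathbb{P}\{\xi_{n+1}=j,\,T_{n+1}-T_n\le t\mid\xi_n\},$$ and $Q(i,j,t)=\mathbb{P}\{\xi_{n+1}=j,T_{n+1}-T_n\le t\mid\xi_n=i\}$ does not depend on $n$. The embedded Markov chain $\{\xi_n\}$ has transition probabilities $p_{ij}=\lim_{t\to\infty}Q(i,j,t)>0$. It is assumed that: 1. $m_i=\mathbb{E}[T_{n+1}-T_n\mid\xi_n=i]<\infty$ for all $i\in E$. 2. There are a constant $1<\alpha<2$ and a locally bounded function $L:\mathbb{R}_+\to\mathbb{R}_+$, slowly varying at infinity (i.e. $\lim_{t\to\infty}L(xt)/L(t)=1$ for all $x>0$), with $\mathbb{P}\{T_{n+1}-T_n\ge t\mid\xi_n=0\}\sim t^{-\alpha}L(t)$ as $t\to\infty$ (the ratio tends to $1$). 3. For $i\neq0$, $\lim_{t\to\infty}\mathbb{P}\{T_{n+1}-T_n\ge t\mid\xi_n=i\}/(t^{-(\alpha+1)}L(t))=0$. 4. The distributions of the sojourn times in the various states have continuous and bounded densities with respect to Lebesgue measure on $\mathbb{R}_+$. Under $\mathbb{P}^*$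 the joint law of the initial state and the initial sojourn is modified (leaving the subsequent dynamics given by $Q$) so that $x$ is a stationary process; $\nu$ denotes the resulting stationary distribution, i.e. the law of $x_t$ under $\mathbb{P}^*$. Let $x^1,x^2,\dots$ be i.i.d. copies of the stationary process $x$ under $\mathbb{P}^*$. **Rate functions.** $\lambda_\pm:E\times\mathbb{R}\to\mathbb{R}_+$ are bounded and Lipschitz continuous; for each $x\in E$ the function $\lambda_\pm(x,\cdot)$ is continuously differentiable with first derivative bounded in absolute value by a constant. Put $\lambda=\lambda_+-\lambda_-$, $\bar\lambda_\pm(s)=\int_E\lambda_\pm(x,s)\,\nu(dx)$ and $\bar\lambda=\bar\lambda_+-\bar\lambda_-$. **Poisson processes.** $\Pi_+$ and $\Pi_-$ are independent standard (unit rate) Poisson processes, independent of $(x^a)_{a\ge1}$, all on one probability space with measure $\mathbb{P}^*$. *)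

theory Defs
  imports "HOL-Probability.Probability"
begin

section \<open>Semi-Markov processes\<close>

text \<open>
  The sigma-algebra generated by \<open>\<xi>\<^sub>0, \<dots>, \<xi>\<^sub>n; T\<^sub>0, \<dots>, T\<^sub>n\<close>.
\<close>
definition history ::
  "'w measure \<Rightarrow> (nat \<Rightarrow> 'w \<Rightarrow> real) \<Rightarrow> (nat \<Rightarrow> 'w \<Rightarrow> real) \<Rightarrow> nat \<Rightarrow> 'w measure" where
  "history M \<xi> T n =
     vimage_algebra (space M) (\<lambda>\<omega>. \<lambda>k\<in>{..n}. (\<xi> k \<omega>, T k \<omega>))
       (\<Pi>\<^sub>M k\<in>{..n}. borel \<Otimes>\<^sub>M borel)"

text \<open>
  The states \<open>\<xi>\<close> and jump times \<open>T\<close> of a semi-Markov process on \<open>E\<close> whose transitions are governed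
  by \<open>Q i j t\<close> from the \<open>k\<close>-th one on. For \<open>k = 0\<close> this is an ordinary semi-Markov process. For
  \<open>k = 1\<close> the initial state, the initial sojourn time and the state entered at its end may have any
  joint law, which is the freedom needed for a stationary version. A conditional probability given
  the event \<open>\<xi>\<^sub>n = i\<close> is constrained only if that event is not null. The parameter \<open>t\<close> ranges over all
  reals, so that \<open>Q i j\<close> is a (defective) distribution function on the whole line.
\<close>
definition semi_markov_from ::
  "nat \<Rightarrow> 'w measure \<Rightarrow> real set \<Rightarrow> (real \<Rightarrow> real \<Rightarrow> real \<Rightarrow> real) \<Rightarrow>
     (nat \<Rightarrow> 'w \<Rightarrow> real) \<Rightarrow> (nat \<Rightarrow> 'w \<Rightarrow> real) \<Rightarrow> bool" where
  "semi_markov_from k M E Q \<xi> T \<longleftrightarrow>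
     (\<forall>n. \<xi> n \<in> borel_measurable M \<and> T n \<in> borel_measurable M) \<and>
     (\<forall>\<omega>\<in>space M. T 0 \<omega> = 0 \<and> (\<forall>n. \<xi> n \<omega> \<in> E \<and> T n \<omega> \<le> T (Suc n) \<omega>)) \<and>
     (\<forall>n\<ge>k. \<forall>j\<in>E. \<forall>t.
        (let A = {\<omega>\<in>space M. \<xi> (Suc n) \<omega> = j \<and> T (Suc n) \<omega> - T n \<omega> \<le> t} in
         AE \<omega> in M. real_cond_exp M (history M \<xi> T n) (indicator A) \<omega>
                  = real_cond_exp M (vimage_algebra (space M) (\<xi> n) borel) (indicator A) \<omega>)) \<and>
     (\<forall>n\<ge>k. \<forall>i\<in>E. \<forall>j\<in>E. \<forall>t. \<P>(\<omega> in M. \<xi> n \<omega> = i) \<noteq> 0 \<longrightarrow>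
        Q i j t = \<P>(\<omega> in M. \<xi> (Suc n) \<omega> = j \<and> T (Suc n) \<omega> - T n \<omega> \<le> t \<bar> \<xi> n \<omega> = i))"

text \<open>For fixed \<open>t\<close> and \<open>\<omega>\<close> at most one term of the series is nonzero.\<close>
definition semi_markov_process ::
  "(nat \<Rightarrow> 'w \<Rightarrow> real) \<Rightarrow> (nat \<Rightarrow> 'w \<Rightarrow> real) \<Rightarrow> real \<Rightarrow> 'w \<Rightarrow> real" where
  "semi_markov_process \<xi> T t \<omega> = (\<Sum>n. \<xi> n \<omega> * indicator {T n \<omega>..<T (Suc n) \<omega>} t)"

text \<open>
  The law of \<open>T\<^sub>n\<^sub>+\<^sub>1 - T\<^sub>n\<close> given \<open>\<xi>\<^sub>n = i\<close>: its distribution function is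
  \<open>\<P>(T\<^sub>n\<^sub>+\<^sub>1 - T\<^sub>n \<le> t | \<xi>\<^sub>n = i) = (\<Sum>j\<in>E. Q i j t)\<close>.
\<close>
definition sojourn_law ::
  "real set \<Rightarrow> (real \<Rightarrow> real \<Rightarrow> real \<Rightarrow> real) \<Rightarrow> real \<Rightarrow> real measure" where
  "sojourn_law E Q i = interval_measure (\<lambda>t. \<Sum>j\<in>E. Q i j t)"

definition slowly_varying :: "(real \<Rightarrow> real) \<Rightarrow> bool" where
  "slowly_varying L \<longleftrightarrow> (\<forall>x>0. ((\<lambda>t. L (x * t) / L t) \<longlongrightarrow> 1) at_top)"

definition kernel_assumptions ::
  "real set \<Rightarrow> (real \<Rightarrow> real \<Rightarrow> real \<Rightarrow> real) \<Rightarrow> real \<Rightarrow> (real \<Rightarrow> real) \<Rightarrow> bool" where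
  "kernel_assumptions E Q \<alpha> L \<longleftrightarrow>
     (\<forall>i\<in>E. \<forall>j\<in>E. \<exists>p>0. (Q i j \<longlongrightarrow> p) at_top) \<and>
     (\<forall>i\<in>E. integrable (sojourn_law E Q i) (\<lambda>t. t)) \<and>
     1 < \<alpha> \<and> \<alpha> < 2 \<and>
     (\<forall>t\<ge>0. 0 \<le> L t) \<and> (\<forall>r\<ge>0. bounded (L ` {0..r})) \<and> slowly_varying L \<and>
     ((\<lambda>t. measure (sojourn_law E Q 0) {t..} / (t powr (-\<alpha>) * L t)) \<longlongrightarrow> 1) at_top \<and>
     (\<forall>i\<in>E - {0}.
        ((\<lambda>t. measure (sojourn_law E Q i) {t..} / (t powr (-(\<alpha> + 1)) * L t)) \<longlongrightarrow> 0) at_top) \<and>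
     (\<forall>i\<in>E. \<exists>f. (\<forall>t\<ge>0. 0 \<le> f t) \<and> continuous_on {0..} f \<and> bounded (f ` {0..}) \<and>
        sojourn_law E Q i = density lborel (\<lambda>t. ennreal (f t * indicator {0..} t)))"


section \<open>Processes as random paths\<close>

definition path_space :: "'b measure \<Rightarrow> (real \<Rightarrow> 'b) measure" where
  "path_space N = (\<Pi>\<^sub>M t\<in>{0..}. N)"

definition sample_path :: "(real \<Rightarrow> 'w \<Rightarrow> 'b) \<Rightarrow> 'w \<Rightarrow> real \<Rightarrow> 'b" where
  "sample_path X \<omega> = (\<lambda>t\<in>{0..}. X t \<omega>)"

definition stationary_process :: "'w measure \<Rightarrow> (real \<Rightarrow> 'w \<Rightarrow> real) \<Rightarrow> bool" where
  "stationary_process M X \<longleftrightarrow>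
     (\<forall>t\<ge>0. X t \<in> borel_measurable M) \<and>
     (\<forall>h\<ge>0. distr M (path_space borel) (sample_path (\<lambda>t. X (t + h)))
           = distr M (path_space borel) (sample_path X))"

definition iid_processes :: "'w measure \<Rightarrow> ('i \<Rightarrow> real \<Rightarrow> 'w \<Rightarrow> real) \<Rightarrow> 'i set \<Rightarrow> bool" where
  "iid_processes M X I \<longleftrightarrow>
     prob_space.indep_vars M (\<lambda>_. path_space borel) (\<lambda>a. sample_path (X a)) I \<and>
     (\<forall>a\<in>I. \<forall>b\<in>I. distr M (path_space borel) (sample_path (X a))
                 = distr M (path_space borel) (sample_path (X b)))"

text \<open>
  The library's \<open>indep_var\<close> requires both random elements to have values in the same type; this is the
  same notion without that restriction.
\<close>
definition indep_elements ::
  "'w measure \<Rightarrow> 'b measure \<Rightarrow> ('w \<Rightarrow> 'b) \<Rightarrow> 'c measure \<Rightarrow> ('w \<Rightarrow> 'c) \<Rightarrow> bool" where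
  "indep_elements M A X B Y \<longleftrightarrow>
     X \<in> M \<rightarrow>\<^sub>M A \<and> Y \<in> M \<rightarrow>\<^sub>M B \<and>
     prob_space.indep_set M (sets (vimage_algebra (space M) X A))
                            (sets (vimage_algebra (space M) Y B))"

definition standard_poisson_process :: "'w measure \<Rightarrow> (real \<Rightarrow> 'w \<Rightarrow> nat) \<Rightarrow> bool" where
  "standard_poisson_process M P \<longleftrightarrow>
     (\<forall>t\<ge>0. P t \<in> M \<rightarrow>\<^sub>M count_space UNIV) \<and>
     (\<forall>\<omega>\<in>space M. P 0 \<omega> = 0 \<and> mono_on {0..} (\<lambda>t. P t \<omega>) \<and>
        (\<forall>t\<ge>0. continuous (at_right t) (\<lambda>r. P r \<omega>))) \<and>
     (\<forall>t. 0 \<le> t 0 \<and> mono t \<longrightarrow>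
        prob_space.indep_vars M (\<lambda>_. count_space UNIV)
          (\<lambda>k \<omega>. P (t (Suc k)) \<omega> - P (t k) \<omega>) (UNIV :: nat set)) \<and>
     (\<forall>r t. 0 \<le> r \<and> r < t \<longrightarrow>
        distr M (count_space UNIV) (\<lambda>\<omega>. P t \<omega> - P r \<omega>) = measure_pmf (poisson_pmf (t - r)))"


section \<open>Rate functions and price processes\<close>

definition rate_function :: "real set \<Rightarrow> (real \<Rightarrow> real \<Rightarrow> real) \<Rightarrow> bool" where
  "rate_function E f \<longleftrightarrow>
     (\<forall>x\<in>E. \<forall>s. 0 \<le> f x s) \<and>
     bounded ((\<lambda>(x, s). f x s) ` (E \<times> UNIV)) \<and>
     (\<exists>C. C-lipschitz_on (E \<times> UNIV) (\<lambda>(x, s). f x s)) \<and>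
     (\<exists>C. \<forall>x\<in>E. f x C1_differentiable_on UNIV \<and> (\<forall>s. \<bar>deriv (f x) s\<bar> \<le> C))"

definition averaged_rate ::
  "real set \<Rightarrow> real measure \<Rightarrow> (real \<Rightarrow> real \<Rightarrow> real) \<Rightarrow> real \<Rightarrow> real" where
  "averaged_rate E \<nu> f s = (LINT x:E|\<nu>. f x s)"

text \<open>
  The equation defining the price \<open>S\<close> in a market with the agents \<open>1, \<dots>, N\<close>. The existence of the
  time integrals is stated because the library integral of a non-integrable function is \<open>0\<close>.
\<close>
definition price_process ::
  "'w measure \<Rightarrow> (real \<Rightarrow> real \<Rightarrow> real) \<Rightarrow> (real \<Rightarrow> real \<Rightarrow> real) \<Rightarrow>
     (real \<Rightarrow> 'w \<Rightarrow> nat) \<Rightarrow> (real \<Rightarrow> 'w \<Rightarrow> nat) \<Rightarrow> (nat \<Rightarrow> real \<Rightarrow> 'w \<Rightarrow> real) \<Rightarrow>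
     nat \<Rightarrow> (real \<Rightarrow> 'w \<Rightarrow> real) \<Rightarrow> bool" where
  "price_process M lp lm Pp Pm X N S \<longleftrightarrow>
     (\<forall>t\<ge>0. S t \<in> borel_measurable M) \<and>
     (\<forall>\<omega>\<in>space M. S 0 \<omega> = 0 \<and> (\<forall>t\<ge>0.
        (\<forall>a\<in>{1..N}. set_integrable lborel {0..t} (\<lambda>u. lp (X a u \<omega>) (S u \<omega>)) \<and>
                    set_integrable lborel {0..t} (\<lambda>u. lm (X a u \<omega>) (S u \<omega>))) \<and>
        S t \<omega> = 1 / real N * real (Pp (\<Sum>a=1..N. LINT u:{0..t}|lborel. lp (X a u \<omega>) (S u \<omega>)) \<omega>)
              - 1 / real N * real (Pm (\<Sum>a=1..N. LINT u:{0..t}|lborel. lm (X a u \<omega>) (S u \<omega>)) \<omega>)))"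

end

theory Submission
  imports Defs
begin

text \<open>
  Let \<open>\<Phi>\<^sub>+\<close> and \<open>\<Phi>\<^sub>-\<close> be the arguments of the two Poisson processes in the equation for \<open>S N t\<close>;
  they are at most of order \<open>N\<close>, uniformly on compact time intervals. By the strong law of large
  numbers the Poisson processes differ from the identity by a sublinear error
  (\<open>standard_poisson_process_sublinear_error\<close>), so up to a vanishing error \<open>S N t\<close> is
  \<open>(\<Phi>\<^sub>+ - \<Phi>\<^sub>-) / N\<close>, the time integral of the average over the agents of their net rates.

  The state space is finite, so the average of \<open>\<lambda> (x a u) r\<close> over the agents is
  \<open>\<Sum>i\<in>E. \<lambda> i r * F N i u\<close>, where \<open>F N i u\<close> is the fraction of agents in state \<open>i\<close> at time \<open>u\<close>. This
  expression separates the agents from the price: although the price depends on all agents, the rates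
  are bounded, and it suffices that the frequencies converge to \<open>\<nu> {i}\<close>. They do so almost surely at
  each fixed time, the agents being independent and stationary (\<open>empirical_frequency_tendsto\<close>), and
  Fubini's theorem turns this into almost sure convergence of their time integrals
  (\<open>AE_time_integral_tendsto_0\<close>).

  Replacing \<open>F N i u\<close> by \<open>\<nu> {i}\<close> turns the integrand into the averaged net rate at the price \<open>S N u\<close>.
  This rate is Lipschitz continuous, so the distance of \<open>S N\<close> from the solution \<open>s\<close> of the differential
  equation satisfies an integral inequality with vanishing inhomogeneity
  (\<open>order_flow_estimate\<close>), and a Gronwall argument (\<open>gronwall_upper_integral\<close>) shows that it tends to
  \<open>0\<close> uniformly on compact intervals (\<open>fluid_limit_pathwise\<close>).
\<close>

section \<open>The strong law of large numbers for Poisson processes\<close>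

text \<open>
  By monotone convergence the sum of the series has finite expectation, so almost surely the series
  converges and its terms vanish.
\<close>
lemma AE_tendsto_0_if_summable_expectations:
  fixes f :: "nat \<Rightarrow> 'a \<Rightarrow> real"
  assumes [measurable]: "\<And>n. f n \<in> borel_measurable M"
    and nonneg: "\<And>n x. 0 \<le> f n x"
    and fin: "(\<Sum>n. \<integral>\<^sup>+x. ennreal (f n x) \<partial>M) \<noteq> \<infinity>"
  shows "AE x in M. (\<lambda>n. f n x) \<longlonglongrightarrow> 0"
proof -
  have "(\<integral>\<^sup>+x. (\<Sum>n. ennreal (f n x)) \<partial>M) = (\<Sum>n. \<integral>\<^sup>+x. ennreal (f n x) \<partial>M)"
    by (intro nn_integral_suminf) auto
  then have "(\<integral>\<^sup>+x. (\<Sum>n. ennreal (f n x)) \<partial>M) \<noteq> \<infinity>"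
    using fin by simp
  then have "AE x in M. (\<Sum>n. ennreal (f n x)) \<noteq> \<infinity>"
    by (intro nn_integral_noteq_infinite) auto
  then show ?thesis
  proof eventually_elim
    case (elim x)
    then have "summable (\<lambda>n. f n x)"
      using nonneg by (intro summable_suminf_not_top) auto
    then show ?case
      by (rule summable_LIMSEQ_zero)
  qed
qed

text \<open>
  The weights \<open>p k\<close> satisfy \<open>(k + 1) p (k + 1) = t p k\<close>, so shifting the summation index turns the
  series for the first and second moments into those of lower order.
\<close>
lemma poisson_second_central_moment:
  assumes t: "0 < t"
  shows "(\<integral>\<^sup>+k. ennreal ((real k - t)\<^sup>2) \<partial>measure_pmf (poisson_pmf t)) = ennreal t"
proof -
  define p where "p k = t ^ k / fact k * exp (- t)" for k :: nat
  have step: "real (Suc k) * p (Suc k) = t * p k" for k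
  proof -
    have "(1 + real k) * (t * t ^ k * exp (- t)) / ((1 + real k) * fact k) = t * t ^ k * exp (- t) / fact k"
      by (rule mult_divide_mult_cancel_left) (use of_nat_0_le_iff[of k] in linarith)
    then show ?thesis
      by (simp add: p_def del: mult_divide_mult_cancel_left_if)
  qed
  have "(\<lambda>k. t ^ k /\<^sub>R fact k) sums exp t"
    by (rule exp_converges)
  then have "(\<lambda>k. t ^ k /\<^sub>R fact k * exp (- t)) sums (exp t * exp (- t))"
    by (rule sums_mult2)
  then have s0: "p sums 1"
    by (simp add: p_def[abs_def] divide_inverse mult.commute mult.left_commute flip: exp_add)
  have "(\<lambda>k. real (Suc k) * p (Suc k)) sums (t * 1)"
    unfolding step by (intro sums_mult s0)
  then have s1: "(\<lambda>k. real k * p k) sums t"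
    by (subst (asm) sums_Suc_iff) simp
  have "(\<lambda>k. (real (Suc k))\<^sup>2 * p (Suc k)) = (\<lambda>k. t * (real k * p k + p k))"
  proof
    fix k
    have "(real (Suc k))\<^sup>2 * p (Suc k) = real (Suc k) * (real (Suc k) * p (Suc k))"
      by (simp only: power2_eq_square mult.assoc)
    also have "\<dots> = t * (real k * p k + p k)"
      unfolding step by (simp add: algebra_simps)
    finally show "(real (Suc k))\<^sup>2 * p (Suc k) = t * (real k * p k + p k)" .
  qed
  moreover have "(\<lambda>k. t * (real k * p k + p k)) sums (t * (t + 1))"
    by (intro sums_mult sums_add s0 s1)
  ultimately have "(\<lambda>k. (real (Suc k))\<^sup>2 * p (Suc k)) sums (t * (t + 1))"
    by simp
  then have s2: "(\<lambda>k. (real k)\<^sup>2 * p k) sums (t * (t + 1))"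
    by (subst (asm) sums_Suc_iff) simp
  have "(\<lambda>k. (real k)\<^sup>2 * p k - 2 * t * (real k * p k) + t\<^sup>2 * p k) sums
      (t * (t + 1) - 2 * t * t + t\<^sup>2 * 1)"
    by (intro sums_add sums_diff sums_mult s0 s1 s2)
  then have s: "(\<lambda>k. p k * (real k - t)\<^sup>2) sums t"
    by (simp add: algebra_simps power2_eq_square)
  have p0: "0 \<le> p k" for k
    using t by (simp add: p_def)
  have "(\<integral>\<^sup>+k. ennreal ((real k - t)\<^sup>2) \<partial>measure_pmf (poisson_pmf t))
      = (\<integral>\<^sup>+k. ennreal (p k) * ennreal ((real k - t)\<^sup>2) \<partial>count_space UNIV)"
    using t by (simp add: nn_integral_measure_pmf p_def)
  also have "\<dots> = (\<Sum>k. ennreal (p k * (real k - t)\<^sup>2))"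
    using p0 by (simp add: nn_integral_count_space_nat ennreal_mult)
  also have "\<dots> = ennreal t"
    using p0 by (intro suminf_ennreal_eq s) auto
  finally show ?thesis .
qed

text \<open>
  A monotone function is controlled between two arguments by its values at them, and consecutive
  squares are relatively so close that growth like the identity along the squares forces it
  everywhere. The bound has a free constant \<open>C\<close> so that it covers small arguments too: put in the form
  \<open>\<bar>f (N u) / N - u\<bar> \<le> \<epsilon> u + C / N\<close> it is uniform on compact intervals of \<open>u\<close>.
\<close>
lemma sublinear_error_if_squares:
  fixes f :: "real \<Rightarrow> real"
  assumes mono: "mono_on {0..} f" and nonneg: "\<And>t. 0 \<le> t \<Longrightarrow> 0 \<le> f t"
    and lim: "(\<lambda>k. (f ((real k)\<^sup>2) - (real k)\<^sup>2) / (real k)\<^sup>2) \<longlonglongrightarrow> 0"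
    and \<epsilon>: "0 < \<epsilon>"
  shows "\<exists>C. \<forall>t\<ge>0. \<bar>f t - t\<bar> \<le> \<epsilon> * t + C"
proof -
  define \<delta> where "\<delta> = min 1 \<epsilon> / 3"
  have \<delta>: "0 < \<delta>" "\<delta> \<le> 1 / 3" "3 * \<delta> \<le> \<epsilon>"
    using \<epsilon> by (auto simp: \<delta>_def)
  \<comment> \<open>Starting at \<open>K \<ge> 1\<close> makes the division by \<open>k\<^sup>2\<close> genuine.\<close>
  obtain K0 where K0: "\<And>k. k \<ge> K0 \<Longrightarrow> \<bar>(f ((real k)\<^sup>2) - (real k)\<^sup>2) / (real k)\<^sup>2\<bar> < \<delta>"
    using lim \<delta>(1) unfolding LIMSEQ_iff by auto
  define K where "K = Suc K0"
  have K: "\<bar>f ((real k)\<^sup>2) - (real k)\<^sup>2\<bar> \<le> \<delta> * (real k)\<^sup>2" if "k \<ge> K" for k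
    using K0[of k] that by (auto simp: K_def abs_divide pos_divide_less_eq)
  define c where "c = 1 / \<delta> + 1"
  have c: "0 \<le> c"
    using \<delta> by (simp add: c_def)
  define C where "C = f ((real K)\<^sup>2) + (real K)\<^sup>2 + 2 * c"
  have "\<bar>f t - t\<bar> \<le> \<epsilon> * t + C" if t: "0 \<le> t" for t
  proof (cases "t < (real K)\<^sup>2")
    case True
    then have "f t \<le> f ((real K)\<^sup>2)"
      using t by (intro mono_onD[OF mono]) auto
    moreover have "0 \<le> \<epsilon> * t"
      using \<epsilon> t by simp
    ultimately show ?thesis
      using True nonneg[OF t] t c unfolding C_def by linarith
  next
    case False
    define k where "k = nat \<lfloor>sqrt t\<rfloor>"
    have kt: "real k \<le> sqrt t" "sqrt t < real k + 1"
      using real_sqrt_ge_zero[OF t] unfolding k_def by linarith+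
    have "real K \<le> sqrt t"
      using False by (simp add: real_le_rsqrt)
    then have kK: "k \<ge> K"
      unfolding k_def by (simp add: le_nat_floor)
    have sq: "(sqrt t)\<^sup>2 = t"
      using t by simp
    have k1: "(real k)\<^sup>2 \<le> t"
      using power_mono[OF kt(1), of 2] sq by simp
    have k2: "t \<le> (real (Suc k))\<^sup>2"
      using power_mono[of "sqrt t" "real (Suc k)" 2] kt t sq by simp
    \<comment> \<open>Neighbouring squares are \<open>2 \<surd>t + 1\<close> apart, and \<open>2 \<surd>t \<le> \<delta> t + 1 / \<delta>\<close>.\<close>
    have "0 \<le> (\<delta> * sqrt t - 1)\<^sup>2 / \<delta>"
      using \<delta> by simp
    also have "\<dots> = \<delta> * t - 2 * sqrt t + 1 / \<delta>"
      using \<delta> t by (simp add: power2_eq_square field_simps)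
    finally have gap: "2 * sqrt t + 1 \<le> \<delta> * t + c"
      by (simp add: c_def)
    have Suc_sq: "(real (Suc k))\<^sup>2 = (real k)\<^sup>2 + 2 * real k + 1"
      by (simp add: power2_eq_square algebra_simps)
    have up: "(real (Suc k))\<^sup>2 \<le> t + (\<delta> * t + c)"
      using Suc_sq k1 kt gap by linarith
    have lo: "t - (\<delta> * t + c) \<le> (real k)\<^sup>2"
      using Suc_sq k2 kt gap by linarith
    have f1: "f ((real k)\<^sup>2) \<le> f t" "f t \<le> f ((real (Suc k))\<^sup>2)"
      using t k1 k2 by (auto intro!: mono_onD[OF mono])
    have f2: "f ((real (Suc k))\<^sup>2) \<le> (1 + \<delta>) * (real (Suc k))\<^sup>2"
      using K[of "Suc k"] kK by (simp add: abs_le_iff algebra_simps)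
    have f3: "(1 - \<delta>) * (real k)\<^sup>2 \<le> f ((real k)\<^sup>2)"
      using K[of k] kK by (simp add: abs_le_iff algebra_simps)
    have f4: "f t \<le> (1 + \<delta>) * (t + (\<delta> * t + c))"
      using f1 f2 mult_left_mono[OF up, of "1 + \<delta>"] \<delta> by linarith
    have f5: "(1 - \<delta>) * (t - (\<delta> * t + c)) \<le> f t"
      using f1 f3 mult_left_mono[OF lo, of "1 - \<delta>"] \<delta> by linarith
    define b where "b = \<delta> * t"
    have bc: "0 \<le> b" "\<delta> * b \<le> b / 3" "\<delta> * c \<le> c / 3" "0 \<le> \<delta> * b" "0 \<le> \<delta> * c"
      using \<delta> t c mult_right_mono[OF \<delta>(2), of b] mult_right_mono[OF \<delta>(2), of c]
      by (auto simp: b_def)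
    have eb: "3 * b \<le> \<epsilon> * t"
      using mult_right_mono[OF \<delta>(3) t] by (simp add: b_def)
    have up': "f t \<le> t + b + c + b + \<delta> * b + \<delta> * c"
      using f4 by (simp add: b_def algebra_simps)
    have lo': "t - b - c - b + \<delta> * b + \<delta> * c \<le> f t"
      using f5 by (simp add: b_def algebra_simps)
    have "2 * c \<le> C"
      using nonneg[of "(real K)\<^sup>2"] by (simp add: C_def)
    then show ?thesis
      using up' lo' bc c eb by (auto simp: abs_le_iff)
  qed
  then show ?thesis
    by blast
qed

text \<open>
  The strong law of large numbers for the Poisson process. The relative error at time \<open>k\<^sup>2\<close> has second
  moment \<open>1 / k\<^sup>2\<close>, which is summable; the times between squares are reached by monotonicity.
\<close>
lemma standard_poisson_process_sublinear_error:
  assumes "prob_space M" and P: "standard_poisson_process M P"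
  shows "AE \<omega> in M. \<forall>\<epsilon>>0. \<exists>C. \<forall>t\<ge>0. \<bar>real (P t \<omega>) - t\<bar> \<le> \<epsilon> * t + C"
proof -
  interpret prob_space M by fact
  have meas: "P t \<in> M \<rightarrow>\<^sub>M count_space UNIV" if "0 \<le> t" for t
    using P that by (auto simp: standard_poisson_process_def)
  \<comment> \<open>The index is shifted to avoid the relative error at time \<open>0\<close>.\<close>
  define D where "D k \<omega> = (real (P ((real (Suc k))\<^sup>2) \<omega>) - (real (Suc k))\<^sup>2) / (real (Suc k))\<^sup>2" for k \<omega>
  have [measurable]: "(\<lambda>\<omega>. (D k \<omega>)\<^sup>2) \<in> borel_measurable M" for k
    using meas[of "(real (Suc k))\<^sup>2", measurable] unfolding D_def by measurable
  have moment: "(\<integral>\<^sup>+\<omega>. ennreal ((D k \<omega>)\<^sup>2) \<partial>M) = ennreal (inverse ((real (Suc k))\<^sup>2))" for k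
  proof -
    define t where "t = (real (Suc k))\<^sup>2"
    have t: "0 < t"
      by (simp add: t_def)
    have P0: "P 0 \<omega> = 0" if "\<omega> \<in> space M" for \<omega>
      using P that by (auto simp: standard_poisson_process_def)
    have [measurable]: "P t \<in> M \<rightarrow>\<^sub>M count_space UNIV" "P 0 \<in> M \<rightarrow>\<^sub>M count_space UNIV"
      using t by (auto intro: meas)
    have "distr M (count_space UNIV) (P t) = distr M (count_space UNIV) (\<lambda>\<omega>. P t \<omega> - P 0 \<omega>)"
      using P0 by (intro distr_cong) auto
    also have "\<dots> = measure_pmf (poisson_pmf t)"
      using P t unfolding standard_poisson_process_def by (metis order_refl diff_zero)
    finally have dist: "distr M (count_space UNIV) (P t) = measure_pmf (poisson_pmf t)" .
    have "(\<integral>\<^sup>+\<omega>. ennreal ((D k \<omega>)\<^sup>2) \<partial>M)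
        = (\<integral>\<^sup>+\<omega>. ennreal (inverse (t\<^sup>2)) * ennreal ((real (P t \<omega>) - t)\<^sup>2) \<partial>M)"
      unfolding D_def t_def[symmetric]
      by (intro nn_integral_cong) (simp add: divide_inverse mult.commute power_mult_distrib power_inverse flip: ennreal_mult)
    also have "\<dots> = ennreal (inverse (t\<^sup>2)) * (\<integral>\<^sup>+\<omega>. ennreal ((real (P t \<omega>) - t)\<^sup>2) \<partial>M)"
      by (intro nn_integral_cmult) measurable
    also have "(\<integral>\<^sup>+\<omega>. ennreal ((real (P t \<omega>) - t)\<^sup>2) \<partial>M)
        = (\<integral>\<^sup>+n. ennreal ((real n - t)\<^sup>2) \<partial>distr M (count_space UNIV) (P t))"
      by (subst nn_integral_distr) auto
    also have "\<dots> = ennreal t"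
      unfolding dist by (rule poisson_second_central_moment[OF t])
    also have "ennreal (inverse (t\<^sup>2)) * ennreal t = ennreal (inverse t)"
      using t by (simp add: power2_eq_square flip: ennreal_mult)
    finally show ?thesis
      by (simp add: t_def)
  qed
  have "summable (\<lambda>k. inverse ((real (Suc k))\<^sup>2))"
    by (rule summable_Suc_iff[of "\<lambda>k. inverse ((real k)\<^sup>2)", THEN iffD2, OF inverse_power_summable]) simp
  then have "(\<Sum>k. \<integral>\<^sup>+\<omega>. ennreal ((D k \<omega>)\<^sup>2) \<partial>M) \<noteq> \<infinity>"
    unfolding moment by (subst suminf_ennreal2) auto
  then have "AE \<omega> in M. (\<lambda>k. (D k \<omega>)\<^sup>2) \<longlonglongrightarrow> 0"
    by (intro AE_tendsto_0_if_summable_expectations) auto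
  then show ?thesis
    using AE_space
  proof eventually_elim
    case (elim \<omega>)
    have "(\<lambda>k. D k \<omega>) \<longlonglongrightarrow> 0"
      using elim(1) by (subst (asm) power_tendsto_0_iff) auto
    then have lim: "(\<lambda>k. (real (P ((real k)\<^sup>2) \<omega>) - (real k)\<^sup>2) / (real k)\<^sup>2) \<longlonglongrightarrow> 0"
      unfolding D_def by (subst filterlim_sequentially_Suc[symmetric]) simp
    have mono: "mono_on {0..} (\<lambda>t. real (P t \<omega>))"
      using P elim(2) by (auto simp: standard_poisson_process_def mono_on_def)
    show ?case
      using sublinear_error_if_squares[OF mono _ lim] by simp
  qed
qed

section \<open>Laws of large numbers for bounded random variables\<close>

text \<open>
  Hoeffding's inequality bounds the probability of a deviation of fixed size by a geometric sequence
  in \<open>N\<close>, so the Borel-Cantelli lemma applies to each of the deviations \<open>1 / (m + 1)\<close>.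
\<close>
lemma (in prob_space) strong_law_bounded_iid:
  fixes X :: "nat \<Rightarrow> 'a \<Rightarrow> real"
  assumes indep: "indep_vars (\<lambda>_. borel) X {1..}"
    and distr: "\<And>a. 1 \<le> a \<Longrightarrow> distr M borel (X a) = distr M borel Y"
    and Y: "Y \<in> borel_measurable M" "AE \<omega> in M. Y \<omega> \<in> {b..c}" and "b < c"
  shows "AE \<omega> in M. (\<lambda>N. (\<Sum>a=1..N. X a \<omega>) / real N) \<longlonglongrightarrow> expectation Y"
proof -
  define A where "A m N = {\<omega>\<in>space M.
    \<bar>(\<Sum>a=1..N. X a \<omega>) / real N - expectation Y\<bar> \<ge> inverse (real (Suc m))}" for m N
  have X: "X a \<in> borel_measurable M" if "1 \<le> a" for a
    using indep that by (auto simp: indep_vars_def)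
  have [measurable]: "(\<lambda>\<omega>. \<Sum>a=1..N. X a \<omega>) \<in> borel_measurable M" for N
    by (intro borel_measurable_sum X) auto
  have A[measurable]: "A m N \<in> sets M" for m N
    unfolding A_def by measurable
  have bound: "prob (A m N) \<le> 2 * exp (- (2 * (inverse (real (Suc m)))\<^sup>2 / (c - b)\<^sup>2)) ^ N" for m N
  proof (cases "N = 0")
    case True
    have "prob (A m N) \<le> 2"
      by (rule order_trans[OF prob_le_1]) simp
    then show ?thesis
      by (simp add: True)
  next
    case False
    interpret H: Hoeffding_ineq_iid M "{1..N}" X Y b c "expectation Y"
    proof unfold_locales
      show "indep_vars (\<lambda>_. borel) X {1..N}"
        by (rule indep_vars_subset[OF indep]) auto
    qed (use distr Y in auto)
    have "prob (A m N) \<le> 2 * exp (- 2 * real N * (inverse (real (Suc m)))\<^sup>2 / (c - b)\<^sup>2)"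
      using H.Hoeffding_ineq_abs_ge'[of "inverse (real (Suc m))"] \<open>b < c\<close> False by (simp add: A_def)
    then show ?thesis
      by (simp add: exp_of_nat_mult[symmetric] algebra_simps)
  qed
  have "AE \<omega> in M. eventually (\<lambda>N. \<omega> \<in> space M - A m N) sequentially" for m
  proof (rule borel_cantelli_AE1)
    define q where "q = exp (- (2 * (inverse (real (Suc m)))\<^sup>2 / (c - b)\<^sup>2))"
    have "norm q < 1"
      using \<open>b < c\<close> by (simp add: q_def)
    then have "summable (\<lambda>N. 2 * q ^ N)"
      by (intro summable_mult summable_geometric)
    then show "summable (\<lambda>N. prob (A m N))"
      by (rule summable_comparison_test') (use bound[of m] in \<open>simp add: q_def\<close>)
  qed (auto simp: emeasure_eq_measure)
  then have "AE \<omega> in M. \<forall>m. eventually (\<lambda>N. \<omega> \<in> space M - A m N) sequentially"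
    by (simp add: AE_all_countable)
  then show ?thesis
  proof eventually_elim
    case (elim \<omega>)
    show ?case
    proof (rule tendstoI)
      fix e :: real assume "0 < e"
      then obtain m where m: "inverse (real (Suc m)) < e"
        using reals_Archimedean by blast
      from elim[rule_format, of m]
      show "eventually (\<lambda>N. dist ((\<Sum>a=1..N. X a \<omega>) / real N) (expectation Y) < e) sequentially"
        by eventually_elim (use m in \<open>auto simp: A_def dist_real_def\<close>)
    qed
  qed
qed

text \<open>
  Convergence almost surely at each fixed time says nothing at once about all times, since the
  exceptional null set depends on the time. By Fubini's theorem, however, for almost every outcome the
  convergence holds at almost every time, and that suffices for the time integrals.
\<close>
lemma (in prob_space) AE_time_integral_tendsto_0:
  fixes D :: "nat \<Rightarrow> real \<Rightarrow> 'a \<Rightarrow> real"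
  assumes [measurable]: "\<And>N. (\<lambda>(u, \<omega>). D N u \<omega>) \<in> borel_measurable (lborel \<Otimes>\<^sub>M M)"
    and bound: "\<And>N u \<omega>. \<bar>D N u \<omega>\<bar> \<le> B"
    and lim: "\<And>u. 0 \<le> u \<Longrightarrow> AE \<omega> in M. (\<lambda>N. D N u \<omega>) \<longlonglongrightarrow> 0"
  shows "AE \<omega> in M. \<forall>\<tau>. (\<lambda>N. LINT u:{0..\<tau>}|lborel. \<bar>D N u \<omega>\<bar>) \<longlonglongrightarrow> 0"
proof -
  interpret pair_sigma_finite lborel M ..
  have ms: "{z \<in> space (lborel \<Otimes>\<^sub>M M). 0 \<le> fst z \<longrightarrow> (\<lambda>N. D N (fst z) (snd z)) \<longlonglongrightarrow> 0}
      \<in> sets (lborel \<Otimes>\<^sub>M M)"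
    by measurable
  have "AE u in lborel. AE \<omega> in M. 0 \<le> u \<longrightarrow> (\<lambda>N. D N u \<omega>) \<longlonglongrightarrow> 0"
  proof (rule AE_I2)
    fix u :: real
    show "AE \<omega> in M. 0 \<le> u \<longrightarrow> (\<lambda>N. D N u \<omega>) \<longlonglongrightarrow> 0"
      using lim[of u] by (cases "0 \<le> u") auto
  qed
  then have "AE \<omega> in M. AE u in lborel. 0 \<le> u \<longrightarrow> (\<lambda>N. D N u \<omega>) \<longlonglongrightarrow> 0"
    by (subst (asm) AE_commute) (use ms in auto)
  then show ?thesis
    using AE_space
  proof eventually_elim
    case (elim \<omega>)
    have D: "(\<lambda>u. D N u \<omega>) \<in> borel_measurable lborel" for N
      using measurable_compose[OF measurable_Pair2'[OF elim(2)], of "\<lambda>(u, \<omega>). D N u \<omega>" lborel borel]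
      by simp
    have "(\<lambda>N. LINT u:{0..\<tau>}|lborel. \<bar>D N u \<omega>\<bar>) \<longlonglongrightarrow> 0" for \<tau>
    proof -
      have "(\<lambda>N. LINT u|lborel. indicator {0..\<tau>} u *\<^sub>R \<bar>D N u \<omega>\<bar>) \<longlonglongrightarrow> (LINT u|(lborel :: real measure). 0)"
      proof (rule integral_dominated_convergence[where w = "\<lambda>u. indicator {0..\<tau>} u *\<^sub>R B"])
        show "integrable lborel (\<lambda>u. indicator {0..\<tau>} u *\<^sub>R B)"
          by (intro integrable_scaleR_left integrable_real_indicator) (auto simp: emeasure_lborel_Icc_eq)
        show "AE u in lborel. (\<lambda>N. indicator {0..\<tau>} u *\<^sub>R \<bar>D N u \<omega>\<bar>) \<longlonglongrightarrow> 0"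
          using elim(1)
        proof eventually_elim
          case (elim u)
          then show ?case
            by (cases "0 \<le> u") (auto split: split_indicator intro: tendsto_rabs_zero)
        qed
      qed (use D bound in \<open>auto split: split_indicator\<close>)
      then show ?thesis
        by (simp add: set_lebesgue_integral_def)
    qed
    then show ?case
      by blast
  qed
qed

section \<open>Paths of semi-Markov processes\<close>

text \<open>
  If the jump times accumulate before \<open>t\<close>, no sojourn interval contains \<open>t\<close> and the process has the
  value \<open>0\<close>; this is where \<open>0 \<in> E\<close> is used.
\<close>
lemma semi_markov_process_in_states:
  assumes sm: "semi_markov_from k M E Q \<xi> T" and "0 \<in> E" and \<omega>: "\<omega> \<in> space M"
  shows "semi_markov_process \<xi> T t \<omega> \<in> E"
proof (cases "\<exists>n. T n \<omega> \<le> t \<and> t < T (Suc n) \<omega>")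
  case True
  then obtain n where n: "T n \<omega> \<le> t" "t < T (Suc n) \<omega>"
    by blast
  have mono: "T i \<omega> \<le> T j \<omega>" if "i \<le> j" for i j
    using sm \<omega> that lift_Suc_mono_le[of "\<lambda>n. T n \<omega>" i j] by (auto simp: semi_markov_from_def)
  have "indicator {T m \<omega>..<T (Suc m) \<omega>} t = (0 :: real)" if "m \<noteq> n" for m
  proof (cases "m < n")
    case True
    then show ?thesis
      using mono[of "Suc m" n] n by (auto simp: indicator_def)
  next
    case False
    then show ?thesis
      using that mono[of "Suc n" m] n by (auto simp: indicator_def)
  qed
  then have "semi_markov_process \<xi> T t \<omega> = (\<Sum>m\<in>{n}. \<xi> m \<omega> * indicator {T m \<omega>..<T (Suc m) \<omega>} t)"
    unfolding semi_markov_process_def by (intro suminf_finite) auto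
  then show ?thesis
    using n sm \<omega> by (simp add: semi_markov_from_def)
next
  case False
  then have "(\<lambda>n. \<xi> n \<omega> * indicator {T n \<omega>..<T (Suc n) \<omega>} t) = (\<lambda>n. 0)"
    by (auto simp: indicator_def)
  then have "semi_markov_process \<xi> T t \<omega> = 0"
    by (simp add: semi_markov_process_def)
  then show ?thesis
    using \<open>0 \<in> E\<close> by simp
qed

text \<open>Measurability jointly in time and outcome is what the exchange of null sets by Fubini needs.\<close>
lemma semi_markov_process_jointly_measurable:
  assumes "semi_markov_from k M E Q \<xi> T"
  shows "(\<lambda>(u, \<omega>). semi_markov_process \<xi> T u \<omega>) \<in> borel_measurable (lborel \<Otimes>\<^sub>M M)"
proof -
  have [measurable]: "\<xi> n \<in> borel_measurable M" "T n \<in> borel_measurable M" for n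
    using assms by (auto simp: semi_markov_from_def)
  have "(\<lambda>(u, \<omega>). semi_markov_process \<xi> T u \<omega>) =
      (\<lambda>(u, \<omega>). \<Sum>n. \<xi> n \<omega> * (if T n \<omega> \<le> u \<and> u < T (Suc n) \<omega> then 1 else 0))"
    by (auto simp: semi_markov_process_def fun_eq_iff indicator_def intro!: suminf_cong)
  also have "\<dots> \<in> borel_measurable (lborel \<Otimes>\<^sub>M M)"
    by measurable
  finally show ?thesis .
qed

section \<open>A Gronwall inequality\<close>

text \<open>
  A Gronwall inequality for a function \<open>h\<close> that need not be measurable: in place of the integral of \<open>h\<close>
  itself, the hypothesis speaks of the integrals of continuous majorants. If \<open>A\<close> is the supremum of
  \<open>h t * exp (- 2 K t)\<close>, then \<open>A * exp (2 K t)\<close> is such a majorant, and its integral is so small that the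
  hypothesis yields \<open>A \<le> \<delta> + A / 2\<close>.
\<close>
lemma gronwall_upper_integral:
  fixes h :: "real \<Rightarrow> real"
  assumes K: "0 < K" and \<tau>: "0 \<le> \<tau>"
    and nonneg: "\<And>t. t \<in> {0..\<tau>} \<Longrightarrow> 0 \<le> h t"
    and bounded: "\<And>t. t \<in> {0..\<tau>} \<Longrightarrow> h t \<le> B"
    and step: "\<And>g t. \<lbrakk>continuous_on {0..\<tau>} g; \<And>u. u \<in> {0..\<tau>} \<Longrightarrow> h u \<le> g u; t \<in> {0..\<tau>}\<rbrakk>
      \<Longrightarrow> h t \<le> \<delta> + K * (LINT u:{0..t}|lborel. g u)"
    and t: "t \<in> {0..\<tau>}"
  shows "h t \<le> 2 * \<delta> * exp (2 * K * \<tau>)"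
proof -
  define w where "w t = exp (2 * K * t)" for t
  define A where "A = (SUP t\<in>{0..\<tau>}. h t / w t)"
  have w: "0 < w t" "1 \<le> w t" if "0 \<le> t" for t
    using K that by (auto simp: w_def)
  have bdd: "bdd_above ((\<lambda>t. h t / w t) ` {0..\<tau>})"
  proof (rule bdd_aboveI2)
    fix t assume t: "t \<in> {0..\<tau>}"
    then have "h t / w t \<le> h t / 1"
      using w[of t] nonneg by (intro divide_left_mono) auto
    then show "h t / w t \<le> B"
      using bounded[OF t] by simp
  qed
  have hA: "h t / w t \<le> A" if "t \<in> {0..\<tau>}" for t
    unfolding A_def using that bdd by (rule cSUP_upper)
  have A0: "0 \<le> A"
    using hA[of 0] nonneg[of 0] w[of 0] \<tau> by (auto intro: order_trans[of _ "h 0 / w 0"])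
  have int: "(LINT u:{0..t}|lborel. A * w u) = A * (w t - 1) / (2 * K)" if "0 \<le> t" for t
  proof -
    have "(LINT u:{0..t}|lborel. A * w u) = A * w t / (2 * K) - A * w 0 / (2 * K)"
      unfolding set_lebesgue_integral_def
    proof (rule integral_FTC_Icc[OF that])
      fix u
      show "((\<lambda>u. A * w u / (2 * K)) has_vector_derivative A * w u) (at u within {0..t})"
        unfolding w_def has_real_derivative_iff_has_vector_derivative[symmetric]
        using K by (auto intro!: derivative_eq_intros)
    qed (auto simp: w_def intro!: continuous_intros)
    then show ?thesis
      by (simp add: w_def right_diff_distrib diff_divide_distrib)
  qed
  have \<delta>: "0 \<le> \<delta>"
    using step[of "\<lambda>u. B" 0] bounded nonneg[of 0] \<tau>
    by (auto simp: set_lebesgue_integral_def)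
  have "A \<le> \<delta> + A / 2"
    unfolding A_def
  proof (rule cSUP_least)
    fix t assume t: "t \<in> {0..\<tau>}"
    have "h t \<le> \<delta> + K * (LINT u:{0..t}|lborel. A * w u)"
    proof (rule step[OF _ _ t])
      show "continuous_on {0..\<tau>} (\<lambda>u. A * w u)"
        by (auto simp: w_def intro!: continuous_intros)
      show "h u \<le> A * w u" if "u \<in> {0..\<tau>}" for u
        using hA[OF that] w[of u] that by (simp add: divide_le_eq mult.commute)
    qed
    also have "\<dots> = \<delta> + A * w t / 2 - A / 2"
      using int[of t] t K by (simp add: right_diff_distrib diff_divide_distrib)
    also have "\<dots> \<le> \<delta> * w t + A * w t / 2"
      using A0 mult_left_mono[of 1 "w t" \<delta>] w[of t] t \<delta> by simp
    finally show "h t / w t \<le> \<delta> + (SUP t\<in>{0..\<tau>}. h t / w t) / 2"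
      using w[of t] t by (simp add: A_def[symmetric] divide_le_eq algebra_simps)
  qed (use \<tau> in auto)
  then have "A \<le> 2 * \<delta>"
    by simp
  moreover have "h t \<le> A * w t"
    using hA[OF t] w[of t] t by (simp add: divide_le_eq mult.commute)
  moreover have "A * w t \<le> A * w \<tau>"
    using A0 t K by (intro mult_left_mono) (auto simp: w_def)
  moreover have "A * w \<tau> \<le> 2 * \<delta> * w \<tau>"
    using w[of \<tau>] \<tau> \<open>A \<le> 2 * \<delta>\<close> by (intro mult_right_mono) auto
  ultimately show ?thesis
    unfolding w_def by linarith
qed

section \<open>Empirical frequencies and averaged rates\<close>

definition empirical_frequency :: "(nat \<Rightarrow> real \<Rightarrow> real) \<Rightarrow> nat \<Rightarrow> real \<Rightarrow> real \<Rightarrow> real" where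
  "empirical_frequency y N i u = (\<Sum>a=1..N. indicator {i} (y a u)) / real N"

lemma empirical_frequency_bounds:
  "0 \<le> empirical_frequency y N i u" "empirical_frequency y N i u \<le> 1"
proof -
  show "0 \<le> empirical_frequency y N i u"
    by (auto simp: empirical_frequency_def intro!: divide_nonneg_nonneg sum_nonneg)
  have "(\<Sum>a=1..N. indicator {i} (y a u)) \<le> (\<Sum>a=1..N. 1 :: real)"
    by (intro sum_mono) (auto simp: indicator_def)
  then show "empirical_frequency y N i u \<le> 1"
    by (cases "N = 0") (auto simp: empirical_frequency_def divide_le_eq)
qed

text \<open>
  Averages over the agents depend on their states only through the empirical frequencies. This
  separates the random states from the price, which enters the weights \<open>\<phi>\<close>.
\<close>
lemma average_eq_sum_empirical_frequency:
  fixes \<phi> :: "real \<Rightarrow> real"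
  assumes "finite E" and "\<And>a. a \<in> {1..N} \<Longrightarrow> y a u \<in> E"
  shows "(\<Sum>a=1..N. \<phi> (y a u)) / real N = (\<Sum>i\<in>E. \<phi> i * empirical_frequency y N i u)"
proof -
  have "\<phi> (y a u) = (\<Sum>i\<in>E. \<phi> i * indicator {i} (y a u))" if "a \<in> {1..N}" for a
  proof -
    have "(\<Sum>i\<in>E. \<phi> i * indicator {i} (y a u)) = (\<Sum>i\<in>E. if i = y a u then \<phi> i else 0)"
      by (intro sum.cong) (auto simp: indicator_def)
    then show ?thesis
      using assms that by simp
  qed
  then have "(\<Sum>a=1..N. \<phi> (y a u)) = (\<Sum>a=1..N. \<Sum>i\<in>E. \<phi> i * indicator {i} (y a u))"
    by (intro sum.cong) auto
  also have "\<dots> = (\<Sum>i\<in>E. \<phi> i * (\<Sum>a=1..N. indicator {i} (y a u)))"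
    by (subst sum.swap) (simp add: sum_distrib_left)
  finally show ?thesis
    by (simp add: empirical_frequency_def sum_divide_distrib[of _ E])
qed

lemma finite_set_integral:
  fixes f :: "real \<Rightarrow> real"
  assumes "finite E" "finite_measure \<nu>" "sets \<nu> = sets borel"
  shows "(LINT x:E|\<nu>. f x) = (\<Sum>i\<in>E. measure \<nu> {i} * f i)"
proof -
  interpret finite_measure \<nu> by fact
  have "indicator E x *\<^sub>R f x = (\<Sum>i\<in>E. f i * indicator {i} x)" for x
  proof -
    have "(\<Sum>i\<in>E. f i * indicator {i} x) = (\<Sum>i\<in>E. if x = i then f i else 0)"
      by (intro sum.cong) (auto simp: indicator_def)
    then show ?thesis
      using assms(1) by (simp add: indicator_def)
  qed
  then have "(LINT x:E|\<nu>. f x) = (LINT x|\<nu>. (\<Sum>i\<in>E. f i * indicator {i} x))"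
    by (simp add: set_lebesgue_integral_def)
  also have "\<dots> = (\<Sum>i\<in>E. LINT x|\<nu>. f i * indicator {i} x)"
    by (intro Bochner_Integration.integral_sum)
      (auto intro!: integrable_mult_right integrable_real_indicator simp: assms(3) emeasure_eq_measure)
  also have "\<dots> = (\<Sum>i\<in>E. measure \<nu> {i} * f i)"
    using sets_eq_imp_space_eq[OF assms(3)] by (intro sum.cong) (auto simp: mult.commute)
  finally show ?thesis .
qed

lemma rate_functionE:
  assumes "rate_function E f"
  obtains C K where "0 < C" "0 < K"
    and "\<And>i r. i \<in> E \<Longrightarrow> 0 \<le> f i r" "\<And>i r. i \<in> E \<Longrightarrow> f i r \<le> C"
    and "\<And>i r r'. i \<in> E \<Longrightarrow> \<bar>f i r - f i r'\<bar> \<le> K * \<bar>r - r'\<bar>"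
proof -
  from assms obtain C where C: "0 < C" "\<And>z. z \<in> (\<lambda>(x, s). f x s) ` (E \<times> UNIV) \<Longrightarrow> norm z \<le> C"
    unfolding rate_function_def bounded_pos by blast
  from assms obtain K where K: "K-lipschitz_on (E \<times> UNIV) (\<lambda>(x, s). f x s)"
    unfolding rate_function_def by blast
  have "f i r \<le> C" if "i \<in> E" for i r
    using C(2)[of "f i r"] that by force
  moreover have "\<bar>f i r - f i r'\<bar> \<le> (\<bar>K\<bar> + 1) * \<bar>r - r'\<bar>" if "i \<in> E" for i r r'
  proof -
    have "\<bar>f i r - f i r'\<bar> \<le> K * \<bar>r - r'\<bar>"
      using lipschitz_onD[OF K, of "(i, r)" "(i, r')"] that by (simp add: dist_real_def dist_Pair_Pair)
    also have "\<dots> \<le> (\<bar>K\<bar> + 1) * \<bar>r - r'\<bar>"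
      by (intro mult_right_mono) auto
    finally show ?thesis .
  qed
  ultimately show ?thesis
    using that[of C "\<bar>K\<bar> + 1"] C(1) assms unfolding rate_function_def by auto
qed

section \<open>Estimates of the order flow\<close>

lemma set_integral_sum:
  fixes f :: "'i \<Rightarrow> 'a \<Rightarrow> real"
  assumes "\<And>i. i \<in> I \<Longrightarrow> set_integrable M A (f i)"
  shows "set_integrable M A (\<lambda>x. \<Sum>i\<in>I. f i x)"
    and "(LINT x:A|M. \<Sum>i\<in>I. f i x) = (\<Sum>i\<in>I. LINT x:A|M. f i x)"
  using assms by (auto simp: set_integrable_def set_lebesgue_integral_def sum_distrib_left
      intro!: Bochner_Integration.integral_sum)

lemma set_integral_mono_domain:
  fixes f :: "real \<Rightarrow> real"
  assumes "set_integrable M B f" "A \<subseteq> B" "A \<in> sets M" "\<And>x. x \<in> B \<Longrightarrow> 0 \<le> f x"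
  shows "(LINT x:A|M. f x) \<le> (LINT x:B|M. f x)"
  unfolding set_lebesgue_integral_def
  using assms set_integrable_subset[OF assms(1,3,2)]
  by (intro integral_mono) (auto simp: set_integrable_def indicator_def)

lemma order_flow_bounds:
  fixes y :: "nat \<Rightarrow> real \<Rightarrow> real" and f :: "real \<Rightarrow> real \<Rightarrow> real" and \<sigma> :: "real \<Rightarrow> real"
  assumes y: "\<And>a u. \<lbrakk>1 \<le> a; 0 \<le> u\<rbrakk> \<Longrightarrow> y a u \<in> E"
    and f: "0 \<le> C" "\<And>i r. i \<in> E \<Longrightarrow> 0 \<le> f i r" "\<And>i r. i \<in> E \<Longrightarrow> f i r \<le> C"
    and t: "0 \<le> t" "t \<le> \<tau>"
    and int: "\<And>a. a \<in> {1..N} \<Longrightarrow> set_integrable lborel {0..t} (\<lambda>u. f (y a u) (\<sigma> u))"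
  defines "\<Phi> \<equiv> (\<Sum>a=1..N. LINT u:{0..t}|lborel. f (y a u) (\<sigma> u))"
  shows "0 \<le> \<Phi>" "\<Phi> \<le> real N * (C * \<tau>)"
proof -
  show "0 \<le> \<Phi>"
    unfolding \<Phi>_def set_lebesgue_integral_def
    using y f(2) by (intro sum_nonneg integral_nonneg_AE) (auto simp: indicator_def)
  have const: "set_integrable lborel {0..t} (\<lambda>u. C)"
    by (intro borel_integrable_atLeastAtMost' continuous_on_const)
  have "(LINT u:{0..t}|lborel. f (y a u) (\<sigma> u)) \<le> C * \<tau>" if a: "a \<in> {1..N}" for a
  proof -
    have "(LINT u:{0..t}|lborel. f (y a u) (\<sigma> u)) \<le> (LINT u:{0..t}|lborel. C)"
      using y f(3) a by (intro set_integral_mono int const) auto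
    also have "\<dots> = C * t"
      using t by (simp add: set_lebesgue_integral_def mult.commute)
    also have "\<dots> \<le> C * \<tau>"
      using t f(1) by (intro mult_left_mono) auto
    finally show ?thesis .
  qed
  then show "\<Phi> \<le> real N * (C * \<tau>)"
    unfolding \<Phi>_def using sum_bounded_above[of "{1..N}" _ "C * \<tau>"] by simp
qed

text \<open>
  Compares the normalized number of orders of one sign with its fluid counterpart. There are three
  sources of error: the relative error of the Poisson process; the deviation of the empirical
  frequencies from \<open>w\<close>; and the distance of the price \<open>\<sigma>\<close> from \<open>s\<close>, which enters through the Lipschitz
  constant. The last one is expressed by a continuous majorant \<open>g\<close>, so that \<open>\<sigma>\<close> need not be measurable
  in time.
\<close>
lemma order_flow_estimate:
  fixes y :: "nat \<Rightarrow> real \<Rightarrow> real" and f :: "real \<Rightarrow> real \<Rightarrow> real" and P :: "real \<Rightarrow> nat"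
    and \<sigma> s g :: "real \<Rightarrow> real"
  assumes E: "finite E" "\<And>a u. \<lbrakk>1 \<le> a; 0 \<le> u\<rbrakk> \<Longrightarrow> y a u \<in> E"
    and f: "0 \<le> K" "0 \<le> C" "\<And>i r. i \<in> E \<Longrightarrow> 0 \<le> f i r" "\<And>i r. i \<in> E \<Longrightarrow> f i r \<le> C"
      "\<And>i r r'. i \<in> E \<Longrightarrow> \<bar>f i r - f i r'\<bar> \<le> K * \<bar>r - r'\<bar>"
    and w: "\<And>i. i \<in> E \<Longrightarrow> 0 \<le> w i" "(\<Sum>i\<in>E. w i) \<le> 1"
    and freq: "\<And>i. i \<in> E \<Longrightarrow> set_integrable lborel {0..\<tau>} (\<lambda>u. \<bar>empirical_frequency y N i u - w i\<bar>)"
    and P: "0 < \<epsilon>" "\<And>t. 0 \<le> t \<Longrightarrow> \<bar>real (P t) - t\<bar> \<le> \<epsilon> * t + c"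
    and t: "0 \<le> t" "t \<le> \<tau>" and N: "1 \<le> N"
    and int: "\<And>a. a \<in> {1..N} \<Longrightarrow> set_integrable lborel {0..t} (\<lambda>u. f (y a u) (\<sigma> u))"
    and s: "continuous_on {0..\<tau>} s"
    and g: "continuous_on {0..\<tau>} g" "\<And>u. u \<in> {0..\<tau>} \<Longrightarrow> \<bar>\<sigma> u - s u\<bar> \<le> g u"
  shows "\<bar>1 / real N * real (P (\<Sum>a=1..N. LINT u:{0..t}|lborel. f (y a u) (\<sigma> u)))
        - (LINT u:{0..t}|lborel. \<Sum>i\<in>E. w i * f i (s u))\<bar>
      \<le> (\<epsilon> * (C * \<tau>) + c / real N
          + C * (\<Sum>i\<in>E. LINT u:{0..\<tau>}|lborel. \<bar>empirical_frequency y N i u - w i\<bar>))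
        + K * (LINT u:{0..t}|lborel. g u)"
proof -
  define \<Phi> where "\<Phi> = (\<Sum>a=1..N. LINT u:{0..t}|lborel. f (y a u) (\<sigma> u))"
  define F where "F u = (\<Sum>a=1..N. f (y a u) (\<sigma> u)) / real N" for u
  define \<eta> where "\<eta> i u = \<bar>empirical_frequency y N i u - w i\<bar>" for i u
  note \<Phi> = order_flow_bounds[where y = y and f = f and \<sigma> = \<sigma> and C = C and E = E and \<tau> = \<tau> and N = N,
      OF E(2) f(2-4) t int, folded \<Phi>_def]
  have \<Phi>C: "\<Phi> / real N \<le> C * \<tau>"
    using \<Phi>(2) N by (simp add: divide_le_eq mult.commute)
  have F: "set_integrable lborel {0..t} F" "(LINT u:{0..t}|lborel. F u) = \<Phi> / real N"
    unfolding F_def \<Phi>_def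
    using set_integral_sum[where I = "{1..N}" and f = "\<lambda>a u. f (y a u) (\<sigma> u)", OF int] N by auto
  have "\<bar>1 / real N * real (P \<Phi>) - \<Phi> / real N\<bar> = \<bar>real (P \<Phi>) - \<Phi>\<bar> / real N"
    by (simp add: abs_divide flip: diff_divide_distrib)
  also have "\<dots> \<le> (\<epsilon> * \<Phi> + c) / real N"
    using P(2)[OF \<Phi>(1)] by (intro divide_right_mono) auto
  also have "\<dots> = \<epsilon> * (\<Phi> / real N) + c / real N"
    by (simp add: add_divide_distrib)
  also have "\<dots> \<le> \<epsilon> * (C * \<tau>) + c / real N"
    using P(1) \<Phi>C by (intro add_right_mono mult_left_mono) auto
  finally have poisson: "\<bar>1 / real N * real (P \<Phi>) - \<Phi> / real N\<bar> \<le> \<epsilon> * (C * \<tau>) + c / real N" .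

  have fs: "continuous_on {0..\<tau>} (\<lambda>u. f i (s u))" if "i \<in> E" for i
  proof -
    have "K-lipschitz_on UNIV (f i)"
      using f(1,5) that by (intro lipschitz_onI) (auto simp: dist_real_def)
    then show ?thesis
      using continuous_on_compose2[OF lipschitz_on_continuous_on s] by auto
  qed
  have sub: "{0..t} \<subseteq> {0..\<tau>}"
    using t by auto
  have G: "set_integrable lborel {0..t} (\<lambda>u. \<Sum>i\<in>E. w i * f i (s u))"
    by (intro borel_integrable_atLeastAtMost' continuous_on_sum continuous_on_mult_left
        continuous_on_subset[OF fs sub])
  have gi: "set_integrable lborel {0..t} g"
    by (intro borel_integrable_atLeastAtMost' continuous_on_subset[OF g(1) sub])
  have \<eta>: "set_integrable lborel {0..\<tau>} (\<eta> i)" if "i \<in> E" for i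
    using freq[OF that] by (simp add: \<eta>_def[abs_def])
  have \<eta>t: "set_integrable lborel {0..t} (\<eta> i)" if "i \<in> E" for i
    using set_integrable_subset[OF \<eta>[OF that] _ sub] by simp
  have \<eta>s: "set_integrable lborel {0..t} (\<lambda>u. \<Sum>i\<in>E. \<eta> i u)"
    "(LINT u:{0..t}|lborel. \<Sum>i\<in>E. \<eta> i u) = (\<Sum>i\<in>E. LINT u:{0..t}|lborel. \<eta> i u)"
    by (rule set_integral_sum[OF \<eta>t]; assumption)+
  have B: "set_integrable lborel {0..t} (\<lambda>u. C * (\<Sum>i\<in>E. \<eta> i u) + K * g u)"
    using \<eta>s gi by (intro set_integral_add set_integrable_mult_right) auto
  have pw: "\<bar>F u - (\<Sum>i\<in>E. w i * f i (s u))\<bar> \<le> C * (\<Sum>i\<in>E. \<eta> i u) + K * g u" if u: "u \<in> {0..t}" for u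
  proof -
    have "F u = (\<Sum>i\<in>E. f i (\<sigma> u) * empirical_frequency y N i u)"
      unfolding F_def
      using u E by (intro average_eq_sum_empirical_frequency[where \<phi> = "\<lambda>i. f i (\<sigma> u)"]) auto
    then have "F u - (\<Sum>i\<in>E. w i * f i (s u))
        = (\<Sum>i\<in>E. f i (\<sigma> u) * (empirical_frequency y N i u - w i))
          + (\<Sum>i\<in>E. w i * (f i (\<sigma> u) - f i (s u)))"
      by (simp add: algebra_simps flip: sum.distrib sum_subtractf)
    moreover have "\<bar>\<Sum>i\<in>E. f i (\<sigma> u) * (empirical_frequency y N i u - w i)\<bar> \<le> (\<Sum>i\<in>E. C * \<eta> i u)"
      using f(3,4) by (intro sum_abs[THEN order_trans] sum_mono)
        (auto simp: \<eta>_def abs_mult intro!: mult_right_mono)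
    moreover have "\<bar>\<Sum>i\<in>E. w i * (f i (\<sigma> u) - f i (s u))\<bar> \<le> (\<Sum>i\<in>E. w i * (K * g u))"
    proof (intro sum_abs[THEN order_trans] sum_mono)
      fix i assume i: "i \<in> E"
      have "\<bar>f i (\<sigma> u) - f i (s u)\<bar> \<le> K * \<bar>\<sigma> u - s u\<bar>"
        using f(5)[OF i] .
      also have "\<dots> \<le> K * g u"
        using g(2)[of u] u sub f(1) by (intro mult_left_mono) auto
      finally show "\<bar>w i * (f i (\<sigma> u) - f i (s u))\<bar> \<le> w i * (K * g u)"
        using w(1)[OF i] by (simp add: abs_mult mult_left_mono)
    qed
    moreover have "(\<Sum>i\<in>E. w i * (K * g u)) \<le> 1 * (K * g u)"
    proof -
      have "0 \<le> g u"
        using g(2)[of u] u sub by (auto intro: order_trans[OF abs_ge_zero])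
      then show ?thesis
        unfolding sum_distrib_right[symmetric] using w(2) f(1) by (intro mult_right_mono) auto
    qed
    ultimately show ?thesis
      by (simp add: sum_distrib_left)
  qed
  have "\<bar>\<Phi> / real N - (LINT u:{0..t}|lborel. \<Sum>i\<in>E. w i * f i (s u))\<bar>
      = \<bar>LINT u:{0..t}|lborel. F u - (\<Sum>i\<in>E. w i * f i (s u))\<bar>"
    using set_integral_diff(2)[OF F(1) G] F(2) by simp
  also have "\<dots> \<le> (LINT u:{0..t}|lborel. \<bar>F u - (\<Sum>i\<in>E. w i * f i (s u))\<bar>)"
    using set_integral_norm_bound[OF set_integral_diff(1)[OF F(1) G]] by simp
  also have "\<dots> \<le> (LINT u:{0..t}|lborel. C * (\<Sum>i\<in>E. \<eta> i u) + K * g u)"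
    by (intro set_integral_mono set_integrable_abs set_integral_diff F G B pw)
  also have "\<dots> = C * (\<Sum>i\<in>E. LINT u:{0..t}|lborel. \<eta> i u) + K * (LINT u:{0..t}|lborel. g u)"
    using \<eta>s gi by (subst set_integral_add) auto
  also have "\<dots> \<le> C * (\<Sum>i\<in>E. LINT u:{0..\<tau>}|lborel. \<eta> i u) + K * (LINT u:{0..t}|lborel. g u)"
    using \<eta> sub f(2)
    by (intro add_right_mono mult_left_mono sum_mono set_integral_mono_domain \<eta>) (auto simp: \<eta>_def)
  finally show ?thesis
    using poisson unfolding \<Phi>_def[symmetric] \<eta>_def by linarith
qed

section \<open>The fluid limit along a path\<close>

text \<open>
  The deterministic core. The paths of the states and of the Poisson processes are fixed and enter
  only through two laws of large numbers: time-integrated convergence of the empirical frequencies, and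
  sublinear errors of the Poisson paths. The estimates for buy and sell orders together give the
  integral inequality required by the Gronwall lemma, with an error term that is arbitrarily small
  for large \<open>N\<close>.
\<close>
lemma fluid_limit_pathwise:
  fixes y :: "nat \<Rightarrow> real \<Rightarrow> real" and fp fm :: "real \<Rightarrow> real \<Rightarrow> real" and Pp Pm :: "real \<Rightarrow> nat"
    and \<sigma> :: "nat \<Rightarrow> real \<Rightarrow> real" and s w :: "real \<Rightarrow> real"
  assumes E: "finite E" "\<And>a u. \<lbrakk>1 \<le> a; 0 \<le> u\<rbrakk> \<Longrightarrow> y a u \<in> E"
    and fp: "rate_function E fp" and fm: "rate_function E fm"
    and w: "\<And>i. i \<in> E \<Longrightarrow> 0 \<le> w i" "(\<Sum>i\<in>E. w i) \<le> 1"
    and freq: "\<And>i N. i \<in> E \<Longrightarrow>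
        set_integrable lborel {0..\<tau>} (\<lambda>u. \<bar>empirical_frequency y N i u - w i\<bar>)"
      "\<And>i. i \<in> E \<Longrightarrow>
        (\<lambda>N. LINT u:{0..\<tau>}|lborel. \<bar>empirical_frequency y N i u - w i\<bar>) \<longlonglongrightarrow> 0"
    and Pp: "\<forall>\<epsilon>>0. \<exists>C. \<forall>t\<ge>0. \<bar>real (Pp t) - t\<bar> \<le> \<epsilon> * t + C"
    and Pm: "\<forall>\<epsilon>>0. \<exists>C. \<forall>t\<ge>0. \<bar>real (Pm t) - t\<bar> \<le> \<epsilon> * t + C"
    and \<tau>: "0 \<le> \<tau>"
    and int: "\<And>N t a. \<lbrakk>1 \<le> N; 0 \<le> t; a \<in> {1..N}\<rbrakk> \<Longrightarrow>
          set_integrable lborel {0..t} (\<lambda>u. fp (y a u) (\<sigma> N u))"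
      "\<And>N t a. \<lbrakk>1 \<le> N; 0 \<le> t; a \<in> {1..N}\<rbrakk> \<Longrightarrow>
          set_integrable lborel {0..t} (\<lambda>u. fm (y a u) (\<sigma> N u))"
    and \<sigma>: "\<And>N t. \<lbrakk>1 \<le> N; 0 \<le> t\<rbrakk> \<Longrightarrow> \<sigma> N t
        = 1 / real N * real (Pp (\<Sum>a=1..N. LINT u:{0..t}|lborel. fp (y a u) (\<sigma> N u)))
          - 1 / real N * real (Pm (\<Sum>a=1..N. LINT u:{0..t}|lborel. fm (y a u) (\<sigma> N u)))"
    and s0: "s 0 = 0"
    and s: "\<And>t. 0 \<le> t \<Longrightarrow>
        (s has_real_derivative (\<Sum>i\<in>E. w i * fp i (s t)) - (\<Sum>i\<in>E. w i * fm i (s t))) (at t within {0..})"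
  shows "uniform_limit {0..\<tau>} \<sigma> s sequentially"
proof -
  obtain Cp Kp where p: "0 < Cp" "0 < Kp"
      "\<And>i r. i \<in> E \<Longrightarrow> 0 \<le> fp i r" "\<And>i r. i \<in> E \<Longrightarrow> fp i r \<le> Cp"
      "\<And>i r r'. i \<in> E \<Longrightarrow> \<bar>fp i r - fp i r'\<bar> \<le> Kp * \<bar>r - r'\<bar>"
    using rate_functionE[OF fp] by metis
  obtain Cm Km where m: "0 < Cm" "0 < Km"
      "\<And>i r. i \<in> E \<Longrightarrow> 0 \<le> fm i r" "\<And>i r. i \<in> E \<Longrightarrow> fm i r \<le> Cm"
      "\<And>i r r'. i \<in> E \<Longrightarrow> \<bar>fm i r - fm i r'\<bar> \<le> Km * \<bar>r - r'\<bar>"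
    using rate_functionE[OF fm] by metis
  define C where "C = Cp + Cm"
  define K where "K = Kp + Km"
  define I where "I N = (\<Sum>i\<in>E. LINT u:{0..\<tau>}|lborel. \<bar>empirical_frequency y N i u - w i\<bar>)" for N
  have CK: "0 < C" "0 < K"
    using p m by (auto simp: C_def K_def)
  have I: "I \<longlonglongrightarrow> 0"
    unfolding I_def[abs_def] by (rule tendsto_null_sum) (rule freq(2))
  have cs: "continuous_on {0..\<tau>} s"
  proof (rule continuous_on_subset)
    show "continuous_on {0..} s"
      using s DERIV_continuous unfolding continuous_on_eq_continuous_within by blast
  qed auto
  have lip_cont: "continuous_on {0..\<tau>} (\<lambda>u. f i (s u))"
    if "0 < L" "\<And>r r'. \<bar>f i r - f i r'\<bar> \<le> L * \<bar>r - r'\<bar>" for f :: "real \<Rightarrow> real \<Rightarrow> real" and i L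
  proof -
    have "L-lipschitz_on UNIV (f i)"
      using that by (intro lipschitz_onI) (auto simp: dist_real_def)
    then show ?thesis
      using continuous_on_compose2[OF lipschitz_on_continuous_on cs] by auto
  qed
  have cp: "continuous_on {0..\<tau>} (\<lambda>u. \<Sum>i\<in>E. w i * fp i (s u))"
    by (intro continuous_on_sum continuous_on_mult_left lip_cont[OF p(2) p(5)])
  have cm: "continuous_on {0..\<tau>} (\<lambda>u. \<Sum>i\<in>E. w i * fm i (s u))"
    by (intro continuous_on_sum continuous_on_mult_left lip_cont[OF m(2) m(5)])
  have s_int: "s t = (LINT u:{0..t}|lborel. \<Sum>i\<in>E. w i * fp i (s u))
      - (LINT u:{0..t}|lborel. \<Sum>i\<in>E. w i * fm i (s u))" if t: "t \<in> {0..\<tau>}" for t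
  proof -
    have sub: "{0..t} \<subseteq> {0..\<tau>}"
      using t by auto
    note cpt = continuous_on_subset[OF cp sub] and cmt = continuous_on_subset[OF cm sub]
    have "(LINT u:{0..t}|lborel. (\<Sum>i\<in>E. w i * fp i (s u)) - (\<Sum>i\<in>E. w i * fm i (s u))) = s t - s 0"
      unfolding set_lebesgue_integral_def
    proof (rule integral_FTC_Icc)
      fix u assume "0 \<le> u" "u \<le> t"
      then show "(s has_vector_derivative (\<Sum>i\<in>E. w i * fp i (s u)) - (\<Sum>i\<in>E. w i * fm i (s u)))
          (at u within {0..t})"
        unfolding has_real_derivative_iff_has_vector_derivative[symmetric]
        by (intro DERIV_subset[OF s]) auto
    qed (use t cpt cmt in \<open>auto intro: continuous_on_diff\<close>)
    then show ?thesis
      using s0 by (subst set_integral_diff(2)[symmetric])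
        (auto intro!: borel_integrable_atLeastAtMost' cpt cmt)
  qed
  have close: "\<bar>\<sigma> N t - s t\<bar> \<le> 2 * (\<epsilon> * (C * \<tau>) + c / real N + C * I N) * exp (2 * K * \<tau>)"
    if \<epsilon>: "0 < \<epsilon>" and N: "1 \<le> N" and t: "t \<in> {0..\<tau>}"
      and c: "c = c1 + c2" "\<And>t. 0 \<le> t \<Longrightarrow> \<bar>real (Pp t) - t\<bar> \<le> \<epsilon> * t + c1"
        "\<And>t. 0 \<le> t \<Longrightarrow> \<bar>real (Pm t) - t\<bar> \<le> \<epsilon> * t + c2"
    for \<epsilon> c c1 c2 N t
  proof -
    have "bounded (s ` {0..\<tau>})"
      using cs by (intro compact_imp_bounded compact_continuous_image) auto
    then have "\<exists>B. \<forall>t\<in>{0..\<tau>}. \<bar>s t\<bar> \<le> B"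
      unfolding bounded_iff by simp
    then obtain B where B: "\<And>t. t \<in> {0..\<tau>} \<Longrightarrow> \<bar>s t\<bar> \<le> B"
      by blast
    have flow_bound: "1 / real N * real (P \<Phi>) \<le> real N * (D * \<tau>) + (\<epsilon> * (real N * (D * \<tau>)) + b)"
      if "0 \<le> \<Phi>" "\<Phi> \<le> real N * (D * \<tau>)" "\<bar>real (P \<Phi>) - \<Phi>\<bar> \<le> \<epsilon> * \<Phi> + b"
      for P :: "real \<Rightarrow> nat" and \<Phi> D b :: real
    proof -
      have "1 / real N * real (P \<Phi>) \<le> real (P \<Phi>)"
        using N mult_left_mono[of 1 "real N" "real (P \<Phi>)"] by (simp add: divide_le_eq)
      moreover have "\<epsilon> * \<Phi> \<le> \<epsilon> * (real N * (D * \<tau>))"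
        using that \<epsilon> by (intro mult_left_mono) auto
      ultimately show ?thesis
        using that by linarith
    qed
    \<comment> \<open>Any a priori bound on the error will do here, even one that grows with \<open>N\<close>.\<close>
    define B' where "B' = B + (real N * (Cp * \<tau>) + (\<epsilon> * (real N * (Cp * \<tau>)) + c1))
      + (real N * (Cm * \<tau>) + (\<epsilon> * (real N * (Cm * \<tau>)) + c2))"
    show ?thesis
    proof (rule gronwall_upper_integral[where h = "\<lambda>t. \<bar>\<sigma> N t - s t\<bar>" and B = B' and \<tau> = \<tau>])
      fix t assume t: "t \<in> {0..\<tau>}"
      then have t': "0 \<le> t" "t \<le> \<tau>"
        by auto
      have bp: "0 \<le> (\<Sum>a=1..N. LINT u:{0..t}|lborel. fp (y a u) (\<sigma> N u))"
        "(\<Sum>a=1..N. LINT u:{0..t}|lborel. fp (y a u) (\<sigma> N u)) \<le> real N * (Cp * \<tau>)"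
        using E(2) p(1,3,4) t' int(1)[OF N t'(1)]
        by (auto intro!: order_flow_bounds[where E = E and y = y and f = fp and \<sigma> = "\<sigma> N"
              and C = Cp and \<tau> = \<tau> and t = t and N = N] simp del: One_nat_def)
      have bm: "0 \<le> (\<Sum>a=1..N. LINT u:{0..t}|lborel. fm (y a u) (\<sigma> N u))"
        "(\<Sum>a=1..N. LINT u:{0..t}|lborel. fm (y a u) (\<sigma> N u)) \<le> real N * (Cm * \<tau>)"
        using E(2) m(1,3,4) t' int(2)[OF N t'(1)]
        by (auto intro!: order_flow_bounds[where E = E and y = y and f = fm and \<sigma> = "\<sigma> N"
              and C = Cm and \<tau> = \<tau> and t = t and N = N] simp del: One_nat_def)
      have up: "1 / real N * real (Pp (\<Sum>a=1..N. LINT u:{0..t}|lborel. fp (y a u) (\<sigma> N u)))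
          \<le> real N * (Cp * \<tau>) + (\<epsilon> * (real N * (Cp * \<tau>)) + c1)"
        using bp c(2)[OF bp(1)] by (rule flow_bound)
      have um: "1 / real N * real (Pm (\<Sum>a=1..N. LINT u:{0..t}|lborel. fm (y a u) (\<sigma> N u)))
          \<le> real N * (Cm * \<tau>) + (\<epsilon> * (real N * (Cm * \<tau>)) + c2)"
        using bm c(3)[OF bm(1)] by (rule flow_bound)
      have nonneg: "0 \<le> 1 / real N * real k" for k
        by simp
      note nonneg[of "Pp (\<Sum>a=1..N. LINT u:{0..t}|lborel. fp (y a u) (\<sigma> N u))"]
        nonneg[of "Pm (\<Sum>a=1..N. LINT u:{0..t}|lborel. fm (y a u) (\<sigma> N u))"]
      then show "\<bar>\<sigma> N t - s t\<bar> \<le> B'"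
        using up um B[OF t] unfolding \<sigma>[OF N t'(1)] B'_def abs_le_iff by linarith
    next
      fix g t
      assume g: "continuous_on {0..\<tau>} g" "\<And>u. u \<in> {0..\<tau>} \<Longrightarrow> \<bar>\<sigma> N u - s u\<bar> \<le> g u" and t: "t \<in> {0..\<tau>}"
      then have t': "0 \<le> t" "t \<le> \<tau>"
        by auto
      note ep = order_flow_estimate[where y = y and f = fp and \<sigma> = "\<sigma> N" and N = N,
          OF E less_imp_le[OF p(2)] less_imp_le[OF p(1)] p(3-5) w freq(1) \<epsilon> c(2) t' N
            int(1)[OF N t'(1)] cs g, folded I_def]
      note em = order_flow_estimate[where y = y and f = fm and \<sigma> = "\<sigma> N" and N = N,
          OF E less_imp_le[OF m(2)] less_imp_le[OF m(1)] m(3-5) w freq(1) \<epsilon> c(3) t' N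
            int(2)[OF N t'(1)] cs g, folded I_def]
      have "\<bar>\<sigma> N t - s t\<bar> \<le> (\<epsilon> * (Cp * \<tau>) + c1 / real N + Cp * I N) + Kp * (LINT u:{0..t}|lborel. g u)
          + ((\<epsilon> * (Cm * \<tau>) + c2 / real N + Cm * I N) + Km * (LINT u:{0..t}|lborel. g u))"
        unfolding \<sigma>[OF N t'(1)] s_int[OF t] using ep em by linarith
      then show "\<bar>\<sigma> N t - s t\<bar> \<le> \<epsilon> * (C * \<tau>) + c / real N + C * I N + K * (LINT u:{0..t}|lborel. g u)"
        by (simp add: C_def K_def c(1) algebra_simps add_divide_distrib)
    qed (use CK \<tau> t in auto)
  qed
  show ?thesis
  proof (rule uniform_limitI)
    fix e :: real assume e: "0 < e"
    define W where "W = exp (2 * K * \<tau>)"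
    have W: "0 < W"
      by (simp add: W_def)
    \<comment> \<open>The relative Poisson error allowed is such that its contribution is at most \<open>e / 2\<close>.\<close>
    define \<epsilon> where "\<epsilon> = e / (4 * C * (\<tau> + 1) * W)"
    have \<epsilon>: "0 < \<epsilon>"
      using e CK \<tau> W by (simp add: \<epsilon>_def)
    obtain c1 where c1: "\<And>t. 0 \<le> t \<Longrightarrow> \<bar>real (Pp t) - t\<bar> \<le> \<epsilon> * t + c1"
      using Pp \<epsilon> by blast
    obtain c2 where c2: "\<And>t. 0 \<le> t \<Longrightarrow> \<bar>real (Pm t) - t\<bar> \<le> \<epsilon> * t + c2"
      using Pm \<epsilon> by blast
    have "(\<lambda>N. 2 * W * ((c1 + c2) / real N + C * I N)) \<longlonglongrightarrow> 2 * W * (0 + C * 0)"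
      by (intro tendsto_intros I lim_const_over_n)
    then have "eventually (\<lambda>N. 2 * W * ((c1 + c2) / real N + C * I N) < e / 2) sequentially"
      using e by (intro order_tendstoD(2)[where y = 0]) auto
    then show "\<forall>\<^sub>F N in sequentially. \<forall>t\<in>{0..\<tau>}. dist (\<sigma> N t) (s t) < e"
      using eventually_ge_at_top[of 1]
    proof eventually_elim
      case (elim N)
      have "2 * (\<epsilon> * (C * \<tau>)) * W = (2 * C * W * e * \<tau>) / (2 * C * W * (2 * (\<tau> + 1)))"
        by (simp add: \<epsilon>_def mult_ac)
      also have "\<dots> = (e / 2) * (\<tau> / (\<tau> + 1))"
        using CK W by simp
      also have "\<dots> \<le> (e / 2) * 1"
        using e \<tau> by (intro mult_left_mono) auto
      finally have small: "2 * (\<epsilon> * (C * \<tau>)) * W \<le> e / 2"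
        by simp
      have split: "2 * (a + b + d) * W = 2 * a * W + 2 * W * (b + d)" for a b d
        by (simp add: algebra_simps)
      have "2 * (\<epsilon> * (C * \<tau>) + (c1 + c2) / real N + C * I N) * W < e"
        using elim(1) small by (subst split) linarith
      then show ?case
        using close[OF \<epsilon> elim(2) _ refl c1 c2] unfolding W_def dist_real_def
        by (blast intro: le_less_trans)
    qed
  qed
qed

section \<open>Convergence of the empirical frequencies\<close>

lemma stationary_marginal:
  assumes "stationary_process M X" and u: "0 \<le> u"
  shows "distr M borel (X u) = distr M borel (X 0)"
proof -
  have X: "X t \<in> borel_measurable M" if "0 \<le> t" for t
    using assms that by (auto simp: stationary_process_def)
  have path: "sample_path (\<lambda>t. X (t + h)) \<in> M \<rightarrow>\<^sub>M path_space borel" if "0 \<le> h" for h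
    unfolding sample_path_def path_space_def using that by (intro measurable_restrict X) auto
  have eval: "(\<lambda>p. p 0) \<in> path_space borel \<rightarrow>\<^sub>M (borel :: real measure)"
    unfolding path_space_def by (intro measurable_component_singleton) auto
  have "distr M borel (X h) = distr (distr M (path_space borel) (sample_path (\<lambda>t. X (t + h)))) borel (\<lambda>p. p 0)"
    if "0 \<le> h" for h
    by (subst distr_distr[OF eval path[OF that]]) (simp add: comp_def sample_path_def)
  note marginal = this
  have "distr M (path_space borel) (sample_path (\<lambda>t. X (t + u)))
      = distr M (path_space borel) (sample_path X)"
    using assms unfolding stationary_process_def by blast
  then show ?thesis
    using marginal[OF u] marginal[of 0] by simp
qed

lemma iid_marginal:
  assumes X: "\<And>a t. \<lbrakk>a \<in> I; 0 \<le> t\<rbrakk> \<Longrightarrow> X a t \<in> borel_measurable M"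
    and iid: "iid_processes M X I" and "a \<in> I" "b \<in> I" and u: "0 \<le> u"
  shows "distr M borel (X a u) = distr M borel (X b u)"
proof -
  have path: "sample_path (X a) \<in> M \<rightarrow>\<^sub>M path_space borel" if "a \<in> I" for a
    unfolding sample_path_def path_space_def using that by (intro measurable_restrict X) auto
  have eval: "(\<lambda>p. p u) \<in> path_space borel \<rightarrow>\<^sub>M (borel :: real measure)"
    unfolding path_space_def using u by (intro measurable_component_singleton) auto
  have "distr M borel (X a u) = distr (distr M (path_space borel) (sample_path (X a))) borel (\<lambda>p. p u)"
    if "a \<in> I" for a
    using u by (subst distr_distr[OF eval path[OF that]]) (simp add: comp_def sample_path_def)
  note marginal = this
  have "distr M (path_space borel) (sample_path (X a)) = distr M (path_space borel) (sample_path (X b))"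
    using iid \<open>a \<in> I\<close> \<open>b \<in> I\<close> unfolding iid_processes_def by blast
  then show ?thesis
    unfolding marginal[OF \<open>a \<in> I\<close>] marginal[OF \<open>b \<in> I\<close>] by (rule arg_cong)
qed

text \<open>
  At a fixed time the indicators of the event that agent \<open>a\<close> is in state \<open>i\<close> are independent and
  identically distributed; by stationarity their mean is the same at all times.
\<close>
lemma (in prob_space) empirical_frequency_tendsto:
  assumes st: "\<And>a. 1 \<le> a \<Longrightarrow> stationary_process M (X a)"
    and iid: "iid_processes M X {1..}" and u: "0 \<le> u"
  shows "AE \<omega> in M. (\<lambda>N. empirical_frequency (\<lambda>a t. X a t \<omega>) N i u)
      \<longlonglongrightarrow> measure (distr M borel (X 1 0)) {i}"
proof -
  have X: "X a t \<in> borel_measurable M" if "1 \<le> a" "0 \<le> t" for a t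
    using st that by (auto simp: stationary_process_def)
  have X10: "X 1 0 \<in> borel_measurable M"
    by (rule X) auto
  have ind[measurable]: "indicator {i} \<in> borel \<rightarrow>\<^sub>M (borel :: real measure)"
    by measurable
  have "(\<lambda>p. indicator {i} (p u)) \<in> path_space borel \<rightarrow>\<^sub>M (borel :: real measure)"
    unfolding path_space_def using u
    by (intro measurable_compose[where f = "\<lambda>p. p u" and N = borel and g = "indicator {i}"]
        measurable_component_singleton ind) auto
  moreover have "indep_vars (\<lambda>_. path_space borel) (\<lambda>a. sample_path (X a)) {1..}"
    using iid unfolding iid_processes_def by blast
  ultimately have "indep_vars (\<lambda>_. borel) (\<lambda>a \<omega>. indicator {i} (sample_path (X a) \<omega> u) :: real) {1..}"
    by (intro indep_vars_compose2[where M' = "\<lambda>_. path_space borel" and X = "\<lambda>a. sample_path (X a)"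
          and Y = "\<lambda>_ p. indicator {i} (p u)"])
  then have indep: "indep_vars (\<lambda>_. borel) (\<lambda>a \<omega>. indicator {i} (X a u \<omega>) :: real) {1..}"
    using u by (simp add: sample_path_def)
  have "AE \<omega> in M. (\<lambda>N. (\<Sum>a=1..N. indicator {i} (X a u \<omega>)) / real N)
      \<longlonglongrightarrow> expectation (\<lambda>\<omega>. indicator {i} (X 1 0 \<omega>))"
  proof (rule strong_law_bounded_iid[where X = "\<lambda>a \<omega>. indicator {i} (X a u \<omega>)" and b = 0 and c = 1])
    show "indep_vars (\<lambda>_. borel) (\<lambda>a \<omega>. indicator {i} (X a u \<omega>) :: real) {1..}"
      by (rule indep)
    fix a :: nat assume a: "1 \<le> a"
    have "distr M borel (X a u) = distr M borel (X 1 0)"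
    proof (rule trans)
      show "distr M borel (X a u) = distr M borel (X 1 u)"
        using a by (intro iid_marginal[OF X iid _ _ u]) auto
      show "distr M borel (X 1 u) = distr M borel (X 1 0)"
        by (intro stationary_marginal st u) simp
    qed
    moreover have "distr M borel (\<lambda>\<omega>. indicator {i} (Z \<omega>) :: real)
        = distr (distr M borel Z) borel (indicator {i})" if "Z \<in> borel_measurable M" for Z
      by (subst distr_distr[OF ind that]) (simp add: comp_def)
    ultimately show "distr M borel (\<lambda>\<omega>. indicator {i} (X a u \<omega>) :: real)
        = distr M borel (\<lambda>\<omega>. indicator {i} (X 1 0 \<omega>))"
      using X[OF a u] X10 by simp
  next
    show "AE \<omega> in M. indicator {i} (X 1 0 \<omega>) \<in> {0..1 :: real}"
      by (simp add: indicator_def)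
    show "(\<lambda>\<omega>. indicator {i} (X 1 0 \<omega>) :: real) \<in> borel_measurable M"
      by (rule measurable_compose[OF X10 ind])
  qed simp
  moreover have "expectation (\<lambda>\<omega>. indicator {i} (X 1 0 \<omega>)) = measure (distr M borel (X 1 0)) {i}"
  proof -
    have "measure (distr M borel (X 1 0)) {i} = (LINT z|distr M borel (X 1 0). indicator {i} z)"
      by simp
    also have "\<dots> = expectation (\<lambda>\<omega>. indicator {i} (X 1 0 \<omega>))"
      by (rule integral_distr[OF X10 ind])
    finally show ?thesis
      by simp
  qed
  ultimately show ?thesis
    by (simp add: empirical_frequency_def)
qed

section \<open>The fluid limit of the price processes\<close>

theorem theorem3p12:
  fixes M :: "'w measure" and E :: "real set"
    and Q :: "real \<Rightarrow> real \<Rightarrow> real \<Rightarrow> real" and \<alpha> :: real and L :: "real \<Rightarrow> real"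
    and \<xi> T :: "nat \<Rightarrow> nat \<Rightarrow> 'w \<Rightarrow> real" and x :: "nat \<Rightarrow> real \<Rightarrow> 'w \<Rightarrow> real"
    and \<nu> :: "real measure"
    and lp lm :: "real \<Rightarrow> real \<Rightarrow> real"
    and Pp Pm :: "real \<Rightarrow> 'w \<Rightarrow> nat"
    and S :: "nat \<Rightarrow> real \<Rightarrow> 'w \<Rightarrow> real" and s :: "real \<Rightarrow> real"
  assumes "prob_space M"
    and "finite E" and "0 \<in> E"
    and "kernel_assumptions E Q \<alpha> L"
    and "\<And>a. a \<ge> 1 \<Longrightarrow> semi_markov_from 1 M E Q (\<xi> a) (T a)"
    and "\<And>a. a \<ge> 1 \<Longrightarrow> x a = semi_markov_process (\<xi> a) (T a)"
    and "\<And>a. a \<ge> 1 \<Longrightarrow> stationary_process M (x a)"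
    and "iid_processes M x {1..}"
    and "\<nu> = distr M borel (x 1 0)"
    and "rate_function E lp" and "rate_function E lm"
    and "standard_poisson_process M Pp" and "standard_poisson_process M Pm"
    and "prob_space.indep_var M
           (path_space (count_space UNIV)) (sample_path Pp)
           (path_space (count_space UNIV)) (sample_path Pm)"
    and "indep_elements M
           (path_space (count_space UNIV) \<Otimes>\<^sub>M path_space (count_space UNIV))
           (\<lambda>\<omega>. (sample_path Pp \<omega>, sample_path Pm \<omega>))
           (\<Pi>\<^sub>M a\<in>{1..}. path_space borel) (\<lambda>\<omega>. \<lambda>a\<in>{1..}. sample_path (x a) \<omega>)"
    and "\<And>N. N \<ge> 1 \<Longrightarrow> price_process M lp lm Pp Pm x N (S N)"
    and "s 0 = 0"
    and "\<And>t. t \<ge> 0 \<Longrightarrow>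
           (s has_real_derivative averaged_rate E \<nu> lp (s t) - averaged_rate E \<nu> lm (s t))
             (at t within {0..})"
  shows "AE \<omega> in M. \<forall>\<tau>\<ge>0. uniform_limit {0..\<tau>} (\<lambda>N t. S N t \<omega>) s sequentially"
proof -
  interpret prob_space M by fact
  note finE = assms(2) and sm = assms(5) and x_def = assms(6) and st = assms(7) and iid = assms(8)
    and \<nu>_def = assms(9) and price = assms(16)
  have x0: "x 1 0 \<in> borel_measurable M"
    using st[of 1] by (auto simp: stationary_process_def)
  interpret \<nu>: prob_space \<nu>
    unfolding \<nu>_def using x0 by (rule prob_space_distr)
  have sets_\<nu>: "sets \<nu> = sets borel"
    by (simp add: \<nu>_def)
  define F where "F N i u \<omega> = empirical_frequency (\<lambda>a t. x a t \<omega>) N i u" for N i u \<omega>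
  have "(\<lambda>(u, \<omega>). x a u \<omega>) \<in> borel_measurable (lborel \<Otimes>\<^sub>M M)" if "1 \<le> a" for a
    unfolding x_def[OF that] by (rule semi_markov_process_jointly_measurable[OF sm[OF that]])
  note x_meas = this
  have ind: "indicator {i} \<in> borel \<rightarrow>\<^sub>M (borel :: real measure)" for i :: real
    by measurable
  have "(\<lambda>z. indicator {i} (x a (fst z) (snd z)) :: real) \<in> borel_measurable (lborel \<Otimes>\<^sub>M M)"
    if "a \<in> {1..N}" for a i N
    using measurable_compose[OF x_meas[of a] ind[of i]] that by (simp add: case_prod_beta)
  then have F_meas: "(\<lambda>(u, \<omega>). F N i u \<omega> - measure \<nu> {i}) \<in> borel_measurable (lborel \<Otimes>\<^sub>M M)" for N i
    unfolding F_def empirical_frequency_def case_prod_beta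
    by (intro borel_measurable_diff borel_measurable_divide borel_measurable_sum borel_measurable_const)
  have F_le: "\<bar>F N i u \<omega> - measure \<nu> {i}\<bar> \<le> 1" for N i u \<omega>
    using empirical_frequency_bounds[of "\<lambda>a t. x a t \<omega>" N i u] \<nu>.prob_le_1[of "{i}"]
      measure_nonneg[of \<nu> "{i}"] unfolding F_def by linarith
  have "AE \<omega> in M. \<forall>\<tau>. (\<lambda>N. LINT u:{0..\<tau>}|lborel. \<bar>F N i u \<omega> - measure \<nu> {i}\<bar>) \<longlonglongrightarrow> 0" for i
  proof (rule AE_time_integral_tendsto_0[OF F_meas F_le])
    fix u :: real assume "0 \<le> u"
    then have "AE \<omega> in M. (\<lambda>N. F N i u \<omega>) \<longlonglongrightarrow> measure \<nu> {i}"
      unfolding \<nu>_def F_def by (intro empirical_frequency_tendsto st iid)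
    then show "AE \<omega> in M. (\<lambda>N. F N i u \<omega> - measure \<nu> {i}) \<longlonglongrightarrow> 0"
      unfolding LIM_zero_iff .
  qed
  then have "AE \<omega> in M. \<forall>i\<in>E. \<forall>\<tau>.
      (\<lambda>N. LINT u:{0..\<tau>}|lborel. \<bar>F N i u \<omega> - measure \<nu> {i}\<bar>) \<longlonglongrightarrow> 0"
    using finE by (intro AE_finite_allI) auto
  then show ?thesis
    using AE_space standard_poisson_process_sublinear_error[OF assms(1,12)]
      standard_poisson_process_sublinear_error[OF assms(1,13)]
  proof eventually_elim
    case (elim \<omega>)
    have rates: "averaged_rate E \<nu> f r = (\<Sum>i\<in>E. measure \<nu> {i} * f i r)" for f r
      unfolding averaged_rate_def by (rule finite_set_integral[OF finE \<nu>.finite_measure sets_\<nu>])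
    have mass: "(\<Sum>i\<in>E. measure \<nu> {i}) \<le> 1"
      using \<nu>.finite_measure_eq_sum_singleton[OF finE] \<nu>.prob_le_1[of E] sets_\<nu> by simp
    have F_int: "set_integrable lborel {0..\<tau>} (\<lambda>u. \<bar>F N i u \<omega> - measure \<nu> {i}\<bar>)" for \<tau> N i
    proof (rule set_integrable_abs, rule set_integrable_bound)
      show "set_integrable lborel {0..\<tau>} (\<lambda>u. 1 :: real)"
        by (intro borel_integrable_atLeastAtMost' continuous_on_const)
      show "set_borel_measurable lborel {0..\<tau>} (\<lambda>u. F N i u \<omega> - measure \<nu> {i})"
        using measurable_compose[OF measurable_Pair2'[OF elim(2)] F_meas[of N i]]
        unfolding set_borel_measurable_def by (intro borel_measurable_scaleR) simp_all
    qed (simp add: F_le)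
    show ?case
    proof (intro allI impI)
      fix \<tau> :: real assume "0 \<le> \<tau>"
      show "uniform_limit {0..\<tau>} (\<lambda>N t. S N t \<omega>) s sequentially"
      proof (rule fluid_limit_pathwise[where y = "\<lambda>a t. x a t \<omega>" and w = "\<lambda>i. measure \<nu> {i}"
            and Pp = "\<lambda>t. Pp t \<omega>" and Pm = "\<lambda>t. Pm t \<omega>" and fp = lp and fm = lm
            and E = E and \<sigma> = "\<lambda>N t. S N t \<omega>"])
        show "x a u \<omega> \<in> E" if "1 \<le> a" "0 \<le> u" for a u
          unfolding x_def[OF that(1)]
          by (rule semi_markov_process_in_states[OF sm[OF that(1)] \<open>0 \<in> E\<close> elim(2)])
        show "set_integrable lborel {0..\<tau>}
            (\<lambda>u. \<bar>empirical_frequency (\<lambda>a t. x a t \<omega>) N i u - measure \<nu> {i}\<bar>)" for i N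
          using F_int by (simp add: F_def)
        show "(\<lambda>N. LINT u:{0..\<tau>}|lborel.
            \<bar>empirical_frequency (\<lambda>a t. x a t \<omega>) N i u - measure \<nu> {i}\<bar>) \<longlonglongrightarrow> 0" if "i \<in> E" for i
          using elim(1) that by (simp add: F_def)
        fix N :: nat and t :: real and a :: nat assume N: "1 \<le> N" and t: "0 \<le> t"
        note pr = price[OF N, unfolded price_process_def, THEN conjunct2, THEN bspec, OF elim(2),
            THEN conjunct2, THEN spec, THEN mp, OF t]
        show "set_integrable lborel {0..t} (\<lambda>u. lp (x a u \<omega>) (S N u \<omega>))"
          "set_integrable lborel {0..t} (\<lambda>u. lm (x a u \<omega>) (S N u \<omega>))" if "a \<in> {1..N}"
          using pr[THEN conjunct1, THEN bspec, OF that] by blast+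
        show "S N t \<omega> = 1 / real N * real (Pp (\<Sum>a=1..N. LINT u:{0..t}|lborel. lp (x a u \<omega>) (S N u \<omega>)) \<omega>)
            - 1 / real N * real (Pm (\<Sum>a=1..N. LINT u:{0..t}|lborel. lm (x a u \<omega>) (S N u \<omega>)) \<omega>)"
          by (rule pr[THEN conjunct2])
      next
        fix t :: real assume "0 \<le> t"
        from assms(18)[OF this]
        show "(s has_real_derivative (\<Sum>i\<in>E. measure \<nu> {i} * lp i (s t))
            - (\<Sum>i\<in>E. measure \<nu> {i} * lm i (s t))) (at t within {0..})"
          unfolding rates .
      qed (use finE assms(10,11,17) mass \<open>0 \<le> \<tau>\<close> elim(3,4) in \<open>simp_all\<close>)
    qed
  qed
qed

end
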